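(* Let $G$ be a triangle. For any $c\in(0,1)$, the normalized number $\widetilde N^G_n$ of the subgraphs in $\mathbb G_n(p_n)$ that are isomorphic to $G$ satisfies $$d_K\big(\widetilde N^G_n,\mathcal N\big)\lesssim\begin{cases}\dfrac{1}{n\sqrt{1-p_n}} & \text{if } c<p_n<1,\\[2mm] \dfrac{1}{n\sqrt{p_n}} & \text{if } n^{-1/2}<p_n\le c,\\[2mm] \dfrac{1}{(np_n)^{3/2}} & \text{if } 0<p_n\le n^{-1/2}.\end{cases}$$
   Context: For positive functions $f,g$, the notation $f\lesssim g$ means that $f\le C_G\,g$ for some constant $C_G>0$ depending only on $G$. $\mathbb G_n(p_n)$ is the Erdős–Rényi random graph obtained by independently retaining each edge of the complete graph $K_n$ on $n$ vertices with probability $p_n\in(0,1)$. $N^G_n$ is the number of (not necessarily induced) subgraphs of $\mathbb G_n(p_n)$ isomorphic to $G$, and $$\widetilde N^G_n=\frac{N^G_n-\mathbb E[N^G_n]}{\sqrt{\mathrm{Var}[N^G_n]}}.$$ $d_K(F,\mathcal N)=\sup_{x\in\mathbb R}|P(F\le x)-P(\mathcal N\le x)|$ is the Kolmogorov distance, where $\mathcal N$ is a standard normal random variable.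
   Formalization: The constant in ≲ may depend on c as well as on G (with a constant depending only on G the claim fails, e.g. for p_n = c = 1 − 1/n²), and n ≥ 3 is assumed so that the normalized count is defined. *)

theory Defs
  imports "HOL-Probability.Probability"
begin

text \<open>A graph is a pair of a vertex set and a set of edges, each edge being a two-element
  set of vertices.\<close>

type_synonym 'a graph = "'a set \<times> 'a set set"

abbreviation verts :: "'a graph \<Rightarrow> 'a set" where
  "verts \<equiv> fst"

abbreviation edges :: "'a graph \<Rightarrow> 'a set set" where
  "edges \<equiv> snd"

definition complete_graph :: "'a set \<Rightarrow> 'a graph" where
  "complete_graph V = (V, {e. e \<subseteq> V \<and> card e = 2})"

definition simple_graph :: "'a graph \<Rightarrow> bool" where
  "simple_graph H \<longleftrightarrow> edges H \<subseteq> edges (complete_graph (verts H))"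

definition is_triangle :: "'a graph \<Rightarrow> bool" where
  "is_triangle G \<longleftrightarrow> (\<exists>V. card V = 3 \<and> G = complete_graph V)"

definition graph_isomorphic :: "'a graph \<Rightarrow> 'b graph \<Rightarrow> bool" where
  "graph_isomorphic H K \<longleftrightarrow>
     (\<exists>f. bij_betw f (verts H) (verts K) \<and> (\<lambda>e. f ` e) ` edges H = edges K)"

text \<open>Subgraphs need not be induced.\<close>

definition subgraph :: "'a graph \<Rightarrow> 'a graph \<Rightarrow> bool" where
  "subgraph H K \<longleftrightarrow> simple_graph H \<and> verts H \<subseteq> verts K \<and> edges H \<subseteq> edges K"

definition subgraph_count :: "'b graph \<Rightarrow> 'a graph \<Rightarrow> nat" where
  "subgraph_count G K = card {H. subgraph H K \<and> graph_isomorphic H G}"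

definition erdos_renyi :: "nat \<Rightarrow> real \<Rightarrow> nat graph pmf" where
  "erdos_renyi n p =
     (let E = edges (complete_graph {1..n})
      in map_pmf (\<lambda>x. ({1..n}, {e \<in> E. x e})) (Pi_pmf E False (\<lambda>_. bernoulli_pmf p)))"

text \<open>For a random variable of variance zero the normalization is the constant 0, by the
  convention for division by zero.\<close>

definition normalized :: "'a measure \<Rightarrow> ('a \<Rightarrow> real) \<Rightarrow> 'a \<Rightarrow> real" where
  "normalized M X \<omega> =
     (X \<omega> - prob_space.expectation M X) / sqrt (prob_space.variance M X)"

definition kolmogorov_dist :: "real measure \<Rightarrow> real measure \<Rightarrow> real" where
  "kolmogorov_dist M N = (SUP x. \<bar>cdf M x - cdf N x\<bar>)"

definition normalized_subgraph_count_law :: "'b graph \<Rightarrow> nat \<Rightarrow> real \<Rightarrow> real measure" where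
  "normalized_subgraph_count_law G n p =
     distr (erdos_renyi n p) borel
       (normalized (erdos_renyi n p) (\<lambda>K. real (subgraph_count G K)))"

end

theory Submission
  imports Defs "HOL-Real_Asymp.Real_Asymp"
begin

text \<open>
  The centred number of triangles is written as \<open>T - \<mu> = \<Sum>\<^sub>e (x\<^sub>e - p) B\<^sub>e\<close> with
  \<open>B\<^sub>e \<ge> 0\<close> independent of the edge indicator \<open>x\<^sub>e\<close>; let \<open>D\<^sub>e \<ge> 0\<close> be the increment of \<open>T\<close> when
  the edge \<open>e\<close> is switched on. For the solution \<open>f\<close> of Stein's equation at \<open>z\<close>, the derivative
  \<open>f'\<close> is a difference of the bounded increasing functions \<open>w f(w)\<close> and \<open>1{w > z}\<close> (up to a
  constant), so the first-order error of \<open>f\<close> between the two values of the normalised count is at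
  most \<open>D\<^sub>e/\<sigma>\<close> times the increment of their sum \<open>H\<close>. Integrating by parts in \<open>x\<^sub>e\<close> in both
  directions turns these increments back into the bounded factor \<open>H\<close>, and with
  \<open>G\<^sub>e = B\<^sub>e D\<^sub>e\<close> one gets
  \<open>d\<^sub>K \<le> (p (1 - p) sqrt (Var (\<Sum>\<^sub>e G\<^sub>e)) + 2 sqrt (E (\<Sum>\<^sub>e (x\<^sub>e - p) G\<^sub>e)\<^sup>2)) / \<sigma>\<^sup>2\<close>.
  The two second moments are controlled by the Efron--Stein inequality and integration by parts,
  because \<open>G\<^sub>e\<close> depends on the edges adjacent to \<open>e\<close> only through the triangles containing \<open>e\<close>.
  With \<open>a = n p\<^sup>2\<close> this yields the single bound
  \<open>d\<^sub>K \<le> C sqrt ((1 + a) / ((1 - p) (n p)\<^sup>3))\<close>, of which the three regimes are special cases.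
\<close>

section \<open>Stein's equation for the normal distribution\<close>

interpretation std_normal: real_distribution std_normal_distribution
  by (rule real_dist_normal_dist)

lemma has_field_derivative_std_normal_density [derivative_intros]:
  "(std_normal_density has_field_derivative - x * std_normal_density x) (at x)"
  unfolding std_normal_density_def
  by (auto intro!: derivative_eq_intros simp: field_simps)

lemma std_normal_density_gt_0: "std_normal_density x > 0"
  by (simp add: normal_density_pos)

lemma std_normal_density_minus: "std_normal_density (- x) = std_normal_density x"
  by (simp add: std_normal_density_def)

lemma continuous_on_std_normal_density: "continuous_on A std_normal_density"
  using has_field_derivative_std_normal_density
  by (meson DERIV_isCont continuous_at_imp_continuous_on)

lemma cdf_std_normal_diff:
  assumes "a \<le> b"
  shows "cdf std_normal_distribution b = cdf std_normal_distribution a + integral {a..b} std_normal_density"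
proof (cases "a = b")
  case False
  with assms have "a < b" by simp
  have int: "set_integrable lborel {a<..b} std_normal_density"
    by (rule set_integrable_subset[OF borel_integrable_atLeastAtMost'[OF
          continuous_on_std_normal_density[of "{a..b}"]]]) auto
  have "cdf std_normal_distribution b - cdf std_normal_distribution a =
      measure std_normal_distribution {a<..b}"
    by (rule std_normal.cdf_diff_eq[OF \<open>a < b\<close>])
  also have "\<dots> = (\<integral>x. indicator {a<..b} x \<partial>std_normal_distribution)"
    by (simp add: Bochner_Integration.integral_indicator)
  also have "\<dots> = (\<integral>x. std_normal_density x * indicator {a<..b} x \<partial>lborel)"
    by (subst integral_density) (auto simp: normal_density_nonneg)
  also have "\<dots> = (LINT x : {a<..b} | lborel. std_normal_density x)"
    by (simp add: set_lebesgue_integral_def mult.commute)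
  also have "\<dots> = integral {a<..b} std_normal_density"
    by (rule set_borel_integral_eq_integral[OF int])
  also have "\<dots> = integral {a..b} std_normal_density"
    by (rule integral_subset_negligible) (auto intro: negligible_subset[of "{a}"])
  finally show ?thesis by simp
qed simp

lemma has_field_derivative_cdf_std_normal [derivative_intros]:
  "(cdf std_normal_distribution has_field_derivative std_normal_density x) (at x)"
proof -
  have "((\<lambda>u. cdf std_normal_distribution (x - 1) + integral {x - 1..u} std_normal_density)
      has_field_derivative std_normal_density x) (at x within {x - 1..x + 1})"
    using integral_has_real_derivative[OF continuous_on_std_normal_density, of x "x - 1" "x + 1"]
    by (auto intro!: derivative_eq_intros)
  then have "(cdf std_normal_distribution has_field_derivative std_normal_density x)
      (at x within {x - 1..x + 1})"
  proof (rule has_field_derivative_transform_within[where d = 1])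
    show "cdf std_normal_distribution (x - 1) + integral {x - 1..u} std_normal_density =
        cdf std_normal_distribution u" if "u \<in> {x - 1..x + 1}" for u
      using cdf_std_normal_diff[of "x - 1" u] that by simp
  qed simp_all
  then show ?thesis
    by (simp add: at_within_interior[of x "{x - 1..x + 1}"])
qed


text \<open>The density is even, so the sum of the two values has derivative zero; its constant
  value is read off from the limits at infinity.\<close>

lemma cdf_std_normal_minus:
  "cdf std_normal_distribution (- x) = 1 - cdf std_normal_distribution x"
proof -
  let ?g = "\<lambda>x. cdf std_normal_distribution x + cdf std_normal_distribution (- x)"
  have der: "(?g has_field_derivative 0) (at x)" for x
    by (auto intro!: derivative_eq_intros DERIV_chain2[OF has_field_derivative_cdf_std_normal]
        simp: std_normal_density_minus)
  have const: "?g x = ?g 0" for x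
    by (rule DERIV_isconst_all) (use der in auto)
  have "(?g \<longlongrightarrow> 1 + 0) at_top"
    by (intro tendsto_add std_normal.cdf_lim_at_top_prob
        filterlim_compose[OF std_normal.cdf_lim_at_bot filterlim_uminus_at_bot_at_top])
  moreover have "(?g \<longlongrightarrow> ?g 0) at_top"
    by (subst const) simp
  ultimately have "?g 0 = 1 + 0"
    by (intro tendsto_unique[OF trivial_limit_at_top_linorder])
  with const[of x] show ?thesis by simp
qed

section \<open>Tail bounds for the normal distribution and the Mills ratio\<close>

text \<open>The function \<open>?g\<close> tends to 0 at minus infinity and has derivative phi(y) /
  y^2 > 0 on the negative half-line, so it is positive at \<open>x\<close>.\<close>

lemma cdf_std_normal_upper:
  assumes "x < 0"
  shows "- x * cdf std_normal_distribution x \<le> std_normal_density x"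
proof -
  let ?g = "\<lambda>x. - (cdf std_normal_distribution x + std_normal_density x / x)"
  have "0 < ?g x"
  proof (rule DERIV_pos_imp_increasing_at_bot[where f = ?g and b = x and flim = 0])
    fix y :: real assume "y \<le> x"
    with assms have "y < 0" by simp
    then show "\<exists>l. (?g has_field_derivative l) (at y) \<and> 0 < l"
      by (intro exI[of _ "std_normal_density y / y\<^sup>2"] conjI divide_pos_pos std_normal_density_gt_0)
        (auto intro!: derivative_eq_intros simp: field_simps power2_eq_square mult_neg_neg)
  next
    have "(std_normal_density \<longlongrightarrow> 0) at_bot"
      unfolding std_normal_density_def by real_asymp
    then have "((\<lambda>x. std_normal_density x / x) \<longlongrightarrow> 0) at_bot"
      by (rule tendsto_divide_0) (simp add: filterlim_at_bot_imp_at_infinity filterlim_ident)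
    from tendsto_minus[OF tendsto_add[OF std_normal.cdf_lim_at_bot this]]
    show "(?g \<longlongrightarrow> 0) at_bot" by simp
  qed
  with assms show ?thesis by (simp add: field_simps)
qed

text \<open>Same scheme: the correction term is chosen so that the derivative of \<open>?g\<close>
  collapses to 2 phi(y) / (1 + y^2)^2. The inequality is exactly what the monotonicity of
  \<open>w * mills w\<close> requires.\<close>

lemma cdf_std_normal_lower:
  "- x * std_normal_density x \<le> (1 + x\<^sup>2) * cdf std_normal_distribution x"
proof -
  let ?g = "\<lambda>x. cdf std_normal_distribution x + std_normal_density x * (x / (1 + x\<^sup>2))"
  have pos: "1 + y\<^sup>2 > 0" for y :: real
    by (rule add_pos_nonneg) auto
  have "0 < ?g x"
  proof (rule DERIV_pos_imp_increasing_at_bot[where f = ?g and b = x and flim = 0])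
    fix y :: real
    let ?d = "std_normal_density y + (- y * std_normal_density y * (y / (1 + y\<^sup>2)) +
      (1 * (1 + y\<^sup>2) - y * (2 * y)) / ((1 + y\<^sup>2) * (1 + y\<^sup>2)) * std_normal_density y)"
    have s: "1 + y\<^sup>2 \<noteq> 0" using pos[of y] by simp
    have "?d = std_normal_density y * (2 / ((1 + y\<^sup>2) * (1 + y\<^sup>2)))"
      using s by (simp add: divide_simps) (simp add: algebra_simps power2_eq_square)
    moreover have "\<dots> > 0"
      using pos[of y] by (intro mult_pos_pos divide_pos_pos std_normal_density_gt_0) simp_all
    moreover have "(?g has_field_derivative ?d) (at y)"
      using s by (intro DERIV_add DERIV_mult DERIV_divide has_field_derivative_cdf_std_normal
          has_field_derivative_std_normal_density) (auto intro!: derivative_eq_intros)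
    ultimately show "\<exists>l. (?g has_field_derivative l) (at y) \<and> 0 < l"
      by (intro exI[of _ ?d]) simp
  next
    have "((\<lambda>x :: real. std_normal_density x * (x / (1 + x\<^sup>2))) \<longlongrightarrow> 0) at_bot"
      unfolding std_normal_density_def by real_asymp
    from tendsto_add[OF std_normal.cdf_lim_at_bot this] show "(?g \<longlongrightarrow> 0) at_bot" by simp
  qed
  with pos[of x] show ?thesis by (simp add: field_simps)
qed

text \<open>The classical Mills ratio (1 - Phi) / phi evaluated at -w. Up to constant factors, it
  and its reflection are the two branches of the Stein solution.\<close>

definition mills :: "real \<Rightarrow> real" where
  "mills w = cdf std_normal_distribution w / std_normal_density w"

lemma has_field_derivative_mills [derivative_intros]:
  "(mills has_field_derivative 1 + w * mills w) (at w)"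
  unfolding mills_def [abs_def] using std_normal_density_gt_0[of w]
  by (auto intro!: derivative_eq_intros simp: divide_simps) (auto simp: algebra_simps)

lemma mills_nonneg: "mills w \<ge> 0"
  by (simp add: mills_def cdf_def normal_density_nonneg)

lemma mult_mills_ge: "w * mills w \<ge> -1"
proof (cases "w < 0")
  case True
  from cdf_std_normal_upper[OF this] show ?thesis
    using std_normal_density_gt_0[of w] by (simp add: mills_def divide_simps)
next
  case False
  then have "0 \<le> w * mills w"
    using mills_nonneg[of w] by simp
  then show ?thesis by linarith
qed

text \<open>The derivative is (1 + x^2) m + x with m = \<open>mills x\<close>, and
  \<open>cdf_std_normal_lower\<close> says that this is nonnegative.\<close>

lemma mult_mills_mono:
  assumes "v \<le> w"
  shows "v * mills v \<le> w * mills w"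
proof (rule DERIV_nonneg_imp_nondecreasing[OF assms], intro exI conjI)
  fix x
  show "((\<lambda>w. w * mills w) has_field_derivative mills x + x * (1 + x * mills x)) (at x)"
    by (auto intro!: derivative_eq_intros)
  from cdf_std_normal_lower[of x] show "0 \<le> mills x + x * (1 + x * mills x)"
    using std_normal_density_gt_0[of x]
    by (simp add: mills_def divide_simps) (simp add: algebra_simps power2_eq_square)
qed

text \<open>The bounded solution of Stein's equation \<open>f' w - w * f w = of_bool (w \<le> z) - \<Phi> z\<close>.\<close>

definition stein_sol :: "real \<Rightarrow> real \<Rightarrow> real" where
  "stein_sol z w =
     (if w \<le> z then (1 - cdf std_normal_distribution z) * mills w
      else cdf std_normal_distribution z * mills (- w))"

text \<open>The two branches agree at \<open>w = z\<close> by the symmetry of Phi and phi, so the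
  right branch may be used on the closed half-line.\<close>

lemma stein_sol_ge:
  assumes "z \<le> w"
  shows "stein_sol z w = cdf std_normal_distribution z * mills (- w)"
proof (cases "w = z")
  case True
  then show ?thesis
    by (simp add: stein_sol_def mills_def cdf_std_normal_minus std_normal_density_minus)
qed (use assms in \<open>simp add: stein_sol_def\<close>)

text \<open>On the left this is a nonnegative multiple of v * mills v; on the right both the
  argument and the sign are reflected, which preserves monotonicity. An interval across
  \<open>z\<close> is cut at \<open>z\<close>, where the branches agree.\<close>

lemma mult_stein_sol_mono: "mono (\<lambda>w. w * stein_sol z w)"
proof -
  let ?P = "cdf std_normal_distribution z"
  have P: "0 \<le> ?P" "?P \<le> 1"
    by (simp_all add: cdf_def std_normal.cdf_bounded_prob[unfolded cdf_def])
  have left: "v * stein_sol z v \<le> w * stein_sol z w" if "v \<le> w" "w \<le> z" for v w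
    using mult_left_mono[OF mult_mills_mono[OF that(1)], of "1 - ?P"] that P
    by (simp add: stein_sol_def mult_ac)
  have right: "v * stein_sol z v \<le> w * stein_sol z w" if "v \<le> w" "z \<le> v" for v w
    using mult_left_mono[OF mult_mills_mono[of "- w" "- v"], of ?P] that P
    by (simp add: stein_sol_ge mult_ac)
  show ?thesis
  proof (rule monoI)
    fix v w :: real
    assume "v \<le> w"
    then consider "w \<le> z" | "z \<le> v" | "v \<le> z" "z \<le> w" by linarith
    then show "v * stein_sol z v \<le> w * stein_sol z w"
      by cases (use left[of v w] right[of v w] left[of v z] right[of z w] \<open>v \<le> w\<close> in auto)
  qed
qed

text \<open>\<open>mult_mills_ge\<close> gives the lower bound left of \<open>z\<close> and the
  upper bound right of it; monotonicity carries each of them to the other side.\<close>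

lemma mult_stein_sol_bounds:
  "cdf std_normal_distribution z - 1 \<le> w * stein_sol z w"
  "w * stein_sol z w \<le> cdf std_normal_distribution z"
proof -
  let ?P = "cdf std_normal_distribution z"
  have P: "0 \<le> ?P" "?P \<le> 1"
    by (simp_all add: cdf_def std_normal.cdf_bounded_prob[unfolded cdf_def])
  have lo: "?P - 1 \<le> v * stein_sol z v" if "v \<le> z" for v
    using mult_left_mono[OF mult_mills_ge[of v], of "1 - ?P"] that P
    by (simp add: stein_sol_def algebra_simps)
  have up: "v * stein_sol z v \<le> ?P" if "z \<le> v" for v
    using mult_left_mono[OF mult_mills_ge[of "- v"], of "?P"] that P
    by (simp add: stein_sol_ge algebra_simps)
  show "?P - 1 \<le> w * stein_sol z w"
    using lo[of w] lo[of z] monoD[OF mult_stein_sol_mono, of z w z] by (cases "w \<le> z") auto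
  show "w * stein_sol z w \<le> ?P"
    using up[of w] up[of z] monoD[OF mult_stein_sol_mono, of w z z] by (cases "z \<le> w") auto
qed

text \<open>The derivative as prescribed by Stein's equation. At the kink \<open>w = z\<close> the
  convention \<open>w \<le> z\<close> selects the derivative of the left branch.\<close>

definition stein_deriv :: "real \<Rightarrow> real \<Rightarrow> real" where
  "stein_deriv z w = w * stein_sol z w + of_bool (w \<le> z) - cdf std_normal_distribution z"

lemma abs_stein_deriv_le: "\<bar>stein_deriv z w\<bar> \<le> 1"
  using mult_stein_sol_bounds[where z = z and w = w]
    std_normal.cdf_bounded_prob[of z] std_normal.cdf_nonneg[of z]
  unfolding stein_deriv_def by (cases "w \<le> z") simp_all

lemma stein_sol_has_derivative_left:
  "w \<le> z \<Longrightarrow> ((\<lambda>w. (1 - cdf std_normal_distribution z) * mills w)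
     has_field_derivative stein_deriv z w) (at w)"
  by (auto intro!: derivative_eq_intros simp: stein_deriv_def stein_sol_def algebra_simps)

lemma stein_sol_has_derivative_right:
  "z < w \<Longrightarrow> ((\<lambda>w. cdf std_normal_distribution z * mills (- w))
     has_field_derivative stein_deriv z w) (at w)"
  by (auto intro!: derivative_eq_intros DERIV_chain2[OF has_field_derivative_mills]
      simp: stein_deriv_def stein_sol_def algebra_simps)

lemma stein_sol_mvt_left:
  assumes "a < b" "b \<le> z"
  obtains c where "a < c" "c < b" "stein_sol z b - stein_sol z a = (b - a) * stein_deriv z c"
proof -
  have "\<exists>c>a. c < b \<and> (1 - cdf std_normal_distribution z) * mills b -
      (1 - cdf std_normal_distribution z) * mills a = (b - a) * stein_deriv z c"
    by (rule MVT2[OF \<open>a < b\<close>]) (use assms in \<open>auto intro!: stein_sol_has_derivative_left\<close>)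
  with assms that show ?thesis by (auto simp: stein_sol_def)
qed

text \<open>If \<open>a = z\<close>, the derivative of the right branch at \<open>a\<close> differs
  from \<open>stein_deriv z z\<close>. Hence the form of the mean value theorem that asks for
  differentiability only inside the interval, combined with uniqueness of derivatives.\<close>

lemma stein_sol_mvt_right:
  assumes "a < b" "z \<le> a"
  obtains c where "a < c" "c < b" "stein_sol z b - stein_sol z a = (b - a) * stein_deriv z c"
proof -
  let ?f = "\<lambda>w. cdf std_normal_distribution z * mills (- w)"
  have "continuous_on {a..b} ?f"
    by (intro continuous_at_imp_continuous_on ballI DERIV_isCont[of ?f])
      (auto intro!: derivative_eq_intros DERIV_chain2[OF has_field_derivative_mills])
  then have "\<exists>l c. a < c \<and> c < b \<and> (?f has_field_derivative l) (at c) \<and> ?f b - ?f a = (b - a) * l"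
  proof (intro MVT)
    show "?f differentiable (at x)" if "a < x" "x < b" for x
      using stein_sol_has_derivative_right[of z x] that assms by (auto simp: real_differentiable_def)
  qed (use assms in auto)
  then obtain l c where c: "a < c" "c < b" "(?f has_field_derivative l) (at c)"
      "?f b - ?f a = (b - a) * l"
    by blast
  with assms have "l = stein_deriv z c"
    by (intro DERIV_unique[OF c(3) stein_sol_has_derivative_right]) simp
  with c assms that show ?thesis by (auto simp: stein_sol_ge)
qed

text \<open>This is \<open>H\<close> of the overview: the two increasing parts of
  \<open>stein_deriv\<close>, added instead of subtracted.\<close>

definition stein_monotone :: "real \<Rightarrow> real \<Rightarrow> real" where
  "stein_monotone z w = w * stein_sol z w + of_bool (z < w)"

text \<open>A mean value inequality across the kink: the interval is split at \<open>z\<close> and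
  the one-sided bounds are added.\<close>

lemma stein_sol_diff_bounds:
  assumes "a \<le> b" "\<And>w. a \<le> w \<Longrightarrow> w \<le> b \<Longrightarrow> l \<le> stein_deriv z w"
    "\<And>w. a \<le> w \<Longrightarrow> w \<le> b \<Longrightarrow> stein_deriv z w \<le> u"
  shows "(b - a) * l \<le> stein_sol z b - stein_sol z a \<and> stein_sol z b - stein_sol z a \<le> (b - a) * u"
proof -
  have left: "(d - c) * l \<le> stein_sol z d - stein_sol z c \<and> stein_sol z d - stein_sol z c \<le> (d - c) * u"
    if "a \<le> c" "c \<le> d" "d \<le> b" "d \<le> z \<or> z \<le> c" for c d
  proof (cases "c = d")
    case False
    with that have "c < d" by simp
    from that(4) obtain x
      where x: "c < x" "x < d" "stein_sol z d - stein_sol z c = (d - c) * stein_deriv z x"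
      using stein_sol_mvt_left[OF \<open>c < d\<close>] stein_sol_mvt_right[OF \<open>c < d\<close>] by metis
    with that have "l \<le> stein_deriv z x" "stein_deriv z x \<le> u"
      by (auto intro!: assms(2,3))
    with \<open>c < d\<close> show ?thesis
      unfolding x(3) by (auto intro!: mult_left_mono)
  qed simp
  show ?thesis
  proof (cases "b \<le> z \<or> z \<le> a")
    case True
    with left[of a b] assms(1) show ?thesis by simp
  next
    case False
    with left[of a z] left[of z b] have
      "(z - a) * l \<le> stein_sol z z - stein_sol z a" "stein_sol z z - stein_sol z a \<le> (z - a) * u"
      "(b - z) * l \<le> stein_sol z b - stein_sol z z" "stein_sol z b - stein_sol z z \<le> (b - z) * u"
      by simp_all
    then show ?thesis by (simp add: algebra_simps)
  qed
qed

text \<open>\<open>stein_deriv z\<close> is, up to a constant, the difference of the two increasing functions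
  \<open>w * stein_sol z w\<close> and \<open>of_bool (z < w)\<close>, so its oscillation on an interval is at most the
  increment of their sum.\<close>

lemma stein_sol_taylor:
  assumes "a \<le> b" "w = a \<or> w = b"
  shows "\<bar>(b - a) * stein_deriv z w - (stein_sol z b - stein_sol z a)\<bar>
    \<le> (b - a) * (stein_monotone z b - stein_monotone z a)"
proof -
  let ?h = "\<lambda>w. w * stein_sol z w" and ?i = "\<lambda>w. of_bool (z < w) :: real"
  let ?P = "cdf std_normal_distribution z"
  \<comment> \<open>The two increasing parts are taken at opposite ends of the interval, so
    \<open>?u - ?l\<close> is precisely the increment of \<open>stein_monotone\<close>.\<close>
  let ?l = "?h a - ?i b + 1 - ?P" and ?u = "?h b - ?i a + 1 - ?P"
  have eq: "stein_deriv z v = ?h v - ?i v + 1 - ?P" for v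
    by (simp add: stein_deriv_def)
  have i: "?i v \<le> ?i v'" if "v \<le> v'" for v v'
    using that by simp
  have h: "?h v \<le> ?h v'" if "v \<le> v'" for v v'
    using monoD[OF mult_stein_sol_mono that] .
  have bds: "?l \<le> stein_deriv z v" "stein_deriv z v \<le> ?u" if "a \<le> v" "v \<le> b" for v
    unfolding eq using i[of a v] i[of v b] h[of a v] h[of v b] that by linarith+
  from stein_sol_diff_bounds[OF assms(1), of ?l z ?u] bds
  have "(b - a) * ?l \<le> stein_sol z b - stein_sol z a" "stein_sol z b - stein_sol z a \<le> (b - a) * ?u"
    by blast+
  moreover have "(b - a) * ?l \<le> (b - a) * stein_deriv z w" "(b - a) * stein_deriv z w \<le> (b - a) * ?u"
    using bds[of w] assms by (auto intro!: mult_left_mono)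
  moreover have "(b - a) * (stein_monotone z b - stein_monotone z a) = (b - a) * ?u - (b - a) * ?l"
    by (simp add: stein_monotone_def algebra_simps)
  ultimately show ?thesis by linarith
qed

lemma abs_stein_monotone_le: "\<bar>stein_monotone z w\<bar> \<le> 2"
  using mult_stein_sol_bounds[where z = z and w = w]
    std_normal.cdf_bounded_prob[of z] std_normal.cdf_nonneg[of z]
  unfolding stein_monotone_def by (cases "z < w") simp_all

section \<open>Normal approximation on the discrete cube\<close>

definition cube_ex :: "real \<Rightarrow> 'i set \<Rightarrow> (('i \<Rightarrow> bool) \<Rightarrow> real) \<Rightarrow> real" where
  "cube_ex p E g = measure_pmf.expectation (Pi_pmf E False (\<lambda>_. bernoulli_pmf p)) g"

definition discrete_diff :: "'i \<Rightarrow> (('i \<Rightarrow> bool) \<Rightarrow> real) \<Rightarrow> ('i \<Rightarrow> bool) \<Rightarrow> real" where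
  "discrete_diff e g x = g (x(e := True)) - g (x(e := False))"

lemma discrete_diff_upd [simp]: "discrete_diff e g (x(e := b)) = discrete_diff e g x"
  by (simp add: discrete_diff_def)

lemma finite_set_Pi_bernoulli:
  assumes "finite E"
  shows "finite (set_pmf (Pi_pmf E False (\<lambda>_. bernoulli_pmf p)))"
  by (rule finite_subset[OF set_Pi_pmf_subset'[OF assms]])
    (intro finite_PiE_dflt assms, simp)

lemma integrable_Pi_bernoulli:
  fixes g :: "('i \<Rightarrow> bool) \<Rightarrow> real"
  assumes "finite E"
  shows "integrable (Pi_pmf E False (\<lambda>_. bernoulli_pmf p)) g"
  by (rule integrable_measure_pmf_finite[OF finite_set_Pi_bernoulli[OF assms]])

lemma cube_ex_const [simp]: "cube_ex p E (\<lambda>_. c) = c"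
  by (simp add: cube_ex_def)

lemma cube_ex_cmult [simp]: "cube_ex p E (\<lambda>x. c * g x) = c * cube_ex p E g"
  by (simp add: cube_ex_def)

lemma cube_ex_minus [simp]: "cube_ex p E (\<lambda>x. - g x) = - cube_ex p E g"
  by (simp add: cube_ex_def)

lemma cube_ex_divide: "cube_ex p E (\<lambda>x. g x / c) = cube_ex p E g / c"
  by (simp add: cube_ex_def)

lemma cube_ex_add:
  "finite E \<Longrightarrow> cube_ex p E (\<lambda>x. g x + h x) = cube_ex p E g + cube_ex p E h"
  unfolding cube_ex_def by (intro Bochner_Integration.integral_add integrable_Pi_bernoulli)

lemma cube_ex_diff:
  "finite E \<Longrightarrow> cube_ex p E (\<lambda>x. g x - h x) = cube_ex p E g - cube_ex p E h"
  unfolding cube_ex_def by (intro Bochner_Integration.integral_diff integrable_Pi_bernoulli)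

lemma cube_ex_sum:
  "finite E \<Longrightarrow> cube_ex p E (\<lambda>x. \<Sum>i\<in>I. g i x) = (\<Sum>i\<in>I. cube_ex p E (g i))"
  unfolding cube_ex_def by (intro Bochner_Integration.integral_sum integrable_Pi_bernoulli)

lemma cube_ex_mono:
  "finite E \<Longrightarrow> (\<And>x. g x \<le> h x) \<Longrightarrow> cube_ex p E g \<le> cube_ex p E h"
  unfolding cube_ex_def by (intro integral_mono integrable_Pi_bernoulli)

lemma cube_ex_nonneg: "(\<And>x. 0 \<le> g x) \<Longrightarrow> 0 \<le> cube_ex p E g"
  unfolding cube_ex_def by simp

lemma abs_cube_ex_le: "\<bar>cube_ex p E g\<bar> \<le> cube_ex p E (\<lambda>x. \<bar>g x\<bar>)"
  unfolding cube_ex_def by (rule integral_abs_bound)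

lemma cube_ex_variance_eq:
  assumes "finite E"
  shows "cube_ex p E (\<lambda>x. (g x - cube_ex p E g)\<^sup>2) =
    cube_ex p E (\<lambda>x. (g x)\<^sup>2) - (cube_ex p E g)\<^sup>2"
  using measure_pmf.variance_eq[OF integrable_Pi_bernoulli[OF assms] integrable_Pi_bernoulli[OF assms]]
  by (simp add: cube_ex_def)

text \<open>Jensen's inequality for the square, from nonnegativity of the variance.\<close>

lemma cube_ex_le_sqrt:
  assumes "finite E"
  shows "cube_ex p E g \<le> sqrt (cube_ex p E (\<lambda>x. (g x)\<^sup>2))"
proof (rule real_le_rsqrt)
  have "0 \<le> cube_ex p E (\<lambda>x. (g x - cube_ex p E g)\<^sup>2)"
    by (rule cube_ex_nonneg) simp
  then show "(cube_ex p E g)\<^sup>2 \<le> cube_ex p E (\<lambda>x. (g x)\<^sup>2)"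
    by (simp add: cube_ex_variance_eq[OF assms])
qed

section \<open>Conditioning on a coordinate, integration by parts, Efron--Stein inequality\<close>

locale bernoulli_cube =
  fixes p :: real
  assumes p_gt_0: "0 < p" and p_less_1: "p < 1"
begin

lemma cube_ex_insert:
  assumes "finite A" "e \<notin> A"
  shows "cube_ex p (insert e A) g =
    p * cube_ex p A (\<lambda>x. g (x(e := True))) + (1 - p) * cube_ex p A (\<lambda>x. g (x(e := False)))"
proof -
  have "Pi_pmf (insert e A) False (\<lambda>_. bernoulli_pmf p) =
      bernoulli_pmf p \<bind> (\<lambda>b. map_pmf (\<lambda>x. x(e := b)) (Pi_pmf A False (\<lambda>_. bernoulli_pmf p)))"
    using assms by (simp add: Pi_pmf_insert' map_pmf_def)
  then have "cube_ex p (insert e A) g =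
      (\<Sum>b\<in>UNIV. pmf (bernoulli_pmf p) b *\<^sub>R cube_ex p A (\<lambda>x. g (x(e := b))))"
    unfolding cube_ex_def
    by (simp only:, subst pmf_expectation_bind[where A = UNIV])
      (auto simp: finite_set_Pi_bernoulli[OF assms(1)])
  also have "\<dots> = p * cube_ex p A (\<lambda>x. g (x(e := True))) + (1 - p) * cube_ex p A (\<lambda>x. g (x(e := False)))"
    using p_gt_0 p_less_1 by (simp add: UNIV_bool)
  finally show ?thesis .
qed

lemma cube_ex_insert_indep:
  assumes "finite A" "e \<notin> A" "\<And>x b. g (x(e := b)) = g x"
  shows "cube_ex p (insert e A) g = cube_ex p A g"
  by (simp add: cube_ex_insert assms) (simp add: algebra_simps)

text \<open>Both inner functions overwrite coordinate \<open>e\<close>, so their averages over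
  \<open>E\<close> and over \<open>E - {e}\<close> coincide. Keeping the full set avoids a change of
  probability space later on.\<close>

lemma cube_ex_split:
  assumes "finite E" "e \<in> E"
  shows "cube_ex p E g =
    p * cube_ex p E (\<lambda>x. g (x(e := True))) + (1 - p) * cube_ex p E (\<lambda>x. g (x(e := False)))"
proof -
  define A where "A = E - {e}"
  have A: "E = insert e A" "e \<notin> A" "finite A"
    using assms by (auto simp: A_def)
  show ?thesis
    unfolding A(1) by (simp add: cube_ex_insert[OF A(3,2), of g] cube_ex_insert_indep[OF A(3,2)])
qed

text \<open>Discrete integration by parts: the centred indicator is 1 - p with probability p and -p
  with probability 1 - p, so both values of \<open>g\<close> get weight p (1 - p) with opposite
  signs.\<close>

lemma cube_ex_centered:
  assumes "finite E" "e \<in> E"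
  shows "cube_ex p E (\<lambda>x. (of_bool (x e) - p) * g x) = p * (1 - p) * cube_ex p E (discrete_diff e g)"
  by (subst cube_ex_split[OF assms])
    (simp add: discrete_diff_def [abs_def] cube_ex_diff[OF assms(1)] algebra_simps)

text \<open>Induction on the coordinates through the law of total variance.\<close>

lemma efron_stein:
  assumes "finite E"
  shows "cube_ex p E (\<lambda>x. (g x)\<^sup>2) - (cube_ex p E g)\<^sup>2 \<le>
    p * (1 - p) * (\<Sum>e\<in>E. cube_ex p E (\<lambda>x. (discrete_diff e g x)\<^sup>2))"
  using assms
proof (induction E arbitrary: g rule: finite_induct)
  case empty
  then show ?case by (simp add: cube_ex_def)
next
  case (insert e A)
  note ins = cube_ex_insert[OF insert.hyps] and ind = cube_ex_insert_indep[OF insert.hyps]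
  note lin = cube_ex_add[OF insert.hyps(1)] cube_ex_diff[OF insert.hyps(1)]
  \<comment> \<open>The conditional expectation of \<open>g\<close> given the coordinates in
    \<open>A\<close>.\<close>
  define h where "h x = p * g (x(e := True)) + (1 - p) * g (x(e := False))" for x
  have ex_h: "cube_ex p (insert e A) g = cube_ex p A h"
    by (simp add: ins h_def [abs_def] lin)
  \<comment> \<open>The second moment of a two-point variable is its squared mean plus p (1 - p)
    times its squared gap.\<close>
  have "p * (g (x(e := True)))\<^sup>2 + (1 - p) * (g (x(e := False)))\<^sup>2 =
      (h x)\<^sup>2 + p * (1 - p) * (discrete_diff e g x)\<^sup>2" for x
    by (simp add: h_def discrete_diff_def power2_eq_square algebra_simps)
  then have ex_sq: "cube_ex p (insert e A) (\<lambda>x. (g x)\<^sup>2) =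
      cube_ex p A (\<lambda>x. (h x)\<^sup>2) + p * (1 - p) * cube_ex p (insert e A) (\<lambda>x. (discrete_diff e g x)\<^sup>2)"
    by (simp add: ins[of "\<lambda>x. (g x)\<^sup>2"] ind[of "\<lambda>x. (discrete_diff e g x)\<^sup>2"]
        flip: lin cube_ex_cmult)
  have "cube_ex p A (\<lambda>x. (discrete_diff f h x)\<^sup>2) \<le> cube_ex p (insert e A) (\<lambda>x. (discrete_diff f g x)\<^sup>2)"
    if "f \<in> A" for f
  proof -
    from that insert.hyps have "f \<noteq> e" by auto
    have "(discrete_diff f h x)\<^sup>2 \<le>
        p * (discrete_diff f g (x(e := True)))\<^sup>2 + (1 - p) * (discrete_diff f g (x(e := False)))\<^sup>2" for x
    proof -
      let ?a = "discrete_diff f g (x(e := True))" and ?b = "discrete_diff f g (x(e := False))"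
      have "discrete_diff f h x = p * ?a + (1 - p) * ?b"
        using \<open>f \<noteq> e\<close> by (simp add: discrete_diff_def h_def fun_upd_twist algebra_simps)
      \<comment> \<open>Jensen for a two-point average, with the defect written out. It shows that
        averaging over \<open>e\<close> does not increase the expected squared difference at
        \<open>f\<close>.\<close>
      moreover have "p * ?a\<^sup>2 + (1 - p) * ?b\<^sup>2 - (p * ?a + (1 - p) * ?b)\<^sup>2 = p * (1 - p) * (?a - ?b)\<^sup>2"
        by (simp add: power2_eq_square algebra_simps)
      moreover have "0 \<le> p * (1 - p) * (?a - ?b)\<^sup>2"
        using p_gt_0 p_less_1 by simp
      ultimately show ?thesis by simp
    qed
    from cube_ex_mono[OF insert.hyps(1) this] show ?thesis
      by (simp add: ins lin)
  qed
  then have "(\<Sum>f\<in>A. cube_ex p A (\<lambda>x. (discrete_diff f h x)\<^sup>2)) \<le>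
      (\<Sum>f\<in>A. cube_ex p (insert e A) (\<lambda>x. (discrete_diff f g x)\<^sup>2))"
    by (rule sum_mono)
  then have "p * (1 - p) * (\<Sum>f\<in>A. cube_ex p A (\<lambda>x. (discrete_diff f h x)\<^sup>2)) \<le>
      p * (1 - p) * (\<Sum>f\<in>A. cube_ex p (insert e A) (\<lambda>x. (discrete_diff f g x)\<^sup>2))"
    using p_gt_0 p_less_1 by (intro mult_left_mono) auto
  with insert.IH[of h] show ?case
    using insert.hyps by (simp add: ex_h ex_sq algebra_simps)
qed


section \<open>Kolmogorov bound by Stein's method\<close>

text \<open>The probabilistic core, free of graph theory. \<open>T_mono\<close> orders the two
  values of the normalised variable in the Taylor step, and \<open>B_nonneg\<close> allows the error
  bound to be multiplied by \<open>B e x\<close>.\<close>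

theorem stein_kolmogorov_bound:
  fixes E :: "'i set" and T :: "('i \<Rightarrow> bool) \<Rightarrow> real" and B :: "'i \<Rightarrow> ('i \<Rightarrow> bool) \<Rightarrow> real"
  defines "G e x \<equiv> B e x * discrete_diff e T x"
  defines "s2 \<equiv> p * (1 - p) * (\<Sum>e\<in>E. cube_ex p E (G e))"
  assumes E: "finite E"
    and T: "\<And>x. T x - \<mu> = (\<Sum>e\<in>E. (of_bool (x e) - p) * B e x)"
    and B_upd: "\<And>e x b. B e (x(e := b)) = B e x"
    and B_nonneg: "\<And>e x. 0 \<le> B e x"
    and T_mono: "\<And>e x. 0 \<le> discrete_diff e T x"
    and s2_pos: "0 < s2"
  shows "cube_ex p E T = \<mu>" (is ?mean)
    and "cube_ex p E (\<lambda>x. (T x - \<mu>)\<^sup>2) = s2" (is ?var)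
    and "\<bar>cube_ex p E (\<lambda>x. of_bool ((T x - \<mu>) / sqrt s2 \<le> z)) - cdf std_normal_distribution z\<bar>
      \<le> (p * (1 - p) * sqrt (cube_ex p E (\<lambda>x. (\<Sum>e\<in>E. G e x)\<^sup>2) - (cube_ex p E (\<lambda>x. \<Sum>e\<in>E. G e x))\<^sup>2) +
        2 * sqrt (cube_ex p E (\<lambda>x. (\<Sum>e\<in>E. (of_bool (x e) - p) * G e x)\<^sup>2))) / s2" (is ?bound)
proof -
  note lin = cube_ex_add[OF E] cube_ex_diff[OF E] cube_ex_sum[OF E]
  have G_upd: "G e (x(e := b)) = G e x" for e x b
    by (simp add: G_def B_upd)
  have G_nonneg: "0 \<le> G e x" for e x
    by (simp add: G_def B_nonneg T_mono)
  \<comment> \<open>\<open>B e\<close> ignores coordinate \<open>e\<close> and can be pulled out of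
    the difference. A constant \<open>g\<close> then yields the mean, and
    \<open>g = T - \<mu>\<close> the variance.\<close>
  have ibp: "cube_ex p E (\<lambda>x. (T x - \<mu>) * g x) =
      p * (1 - p) * (\<Sum>e\<in>E. cube_ex p E (\<lambda>x. B e x * discrete_diff e g x))" for g
  proof -
    have "cube_ex p E (\<lambda>x. (T x - \<mu>) * g x) =
        (\<Sum>e\<in>E. cube_ex p E (\<lambda>x. (of_bool (x e) - p) * (B e x * g x)))"
      by (simp add: T sum_distrib_right mult.assoc lin)
    also have "\<dots> = (\<Sum>e\<in>E. p * (1 - p) * cube_ex p E (\<lambda>x. B e x * discrete_diff e g x))"
      by (intro sum.cong refl, subst cube_ex_centered[OF E])
        (simp_all add: discrete_diff_def [abs_def] B_upd right_diff_distrib)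
    finally show ?thesis by (simp add: sum_distrib_left)
  qed
  have centered: "cube_ex p E (\<lambda>x. T x - \<mu>) = 0"
    using ibp[of "\<lambda>_. 1"] by (simp add: discrete_diff_def)
  then show ?mean by (simp add: lin)
  show ?var
    using ibp[of "\<lambda>x. T x - \<mu>"] unfolding s2_def G_def
    by (simp add: power2_eq_square discrete_diff_def)

  define s where "s = sqrt s2"
  have s: "s > 0" "s\<^sup>2 = s2" "s * s = s2"
    using s2_pos by (simp_all add: s_def)
  define W where "W x = (T x - \<mu>) / s" for x
  let ?f = "stein_sol z" and ?f' = "stein_deriv z" and ?H = "stein_monotone z"
  \<comment> \<open>\<open>R\<close> acts as a Stein kernel of \<open>W\<close>: it has mean 1 by
    the definition of \<open>s2\<close>, and its fluctuation is one of the two error terms.\<close>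
  define R where "R x = p * (1 - p) * (\<Sum>e\<in>E. G e x) / s2" for x
  define Y where "Y x = (\<Sum>e\<in>E. (of_bool (x e) - p) * G e x)" for x
  have pq: "0 < p * (1 - p)" using p_gt_0 p_less_1 by simp
  have W_diff: "discrete_diff e W x = discrete_diff e T x / s" for e x
    by (simp add: discrete_diff_def W_def diff_divide_distrib)

  have "cube_ex p E (\<lambda>x. ?f' (W x)) = cube_ex p E (\<lambda>x. W x * ?f (W x)) +
      cube_ex p E (\<lambda>x. of_bool (W x \<le> z)) - cdf std_normal_distribution z"
    by (simp add: stein_deriv_def lin)
  \<comment> \<open>Stein's equation at \<open>W\<close>, with f'(W) R added and subtracted. The
    first term is the deviation of the kernel from 1, the second the error of replacing differences
    of f by derivatives.\<close>
  then have main: "cube_ex p E (\<lambda>x. of_bool (W x \<le> z)) - cdf std_normal_distribution z =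
      cube_ex p E (\<lambda>x. ?f' (W x) * (1 - R x)) +
      (cube_ex p E (\<lambda>x. ?f' (W x) * R x) - cube_ex p E (\<lambda>x. W x * ?f (W x)))"
    by (simp add: right_diff_distrib lin)

  have ex_R: "cube_ex p E R = 1"
  proof -
    have "cube_ex p E R = p * (1 - p) * (\<Sum>e\<in>E. cube_ex p E (G e)) / s2"
      unfolding R_def [abs_def] cube_ex_divide cube_ex_cmult lin ..
    also have "\<dots> = 1"
      unfolding s2_def [symmetric] using s2_pos by simp
    finally show ?thesis .
  qed
  have "\<bar>cube_ex p E (\<lambda>x. ?f' (W x) * (1 - R x))\<bar> \<le> cube_ex p E (\<lambda>x. \<bar>?f' (W x) * (1 - R x)\<bar>)"
    by (rule abs_cube_ex_le)
  also have "\<dots> \<le> cube_ex p E (\<lambda>x. \<bar>1 - R x\<bar>)"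
    using abs_stein_deriv_le by (intro cube_ex_mono E) (auto simp: abs_mult intro!: mult_left_le_one_le)
  also have "\<dots> \<le> sqrt (cube_ex p E (\<lambda>x. (R x - cube_ex p E R)\<^sup>2))"
    using cube_ex_le_sqrt[OF E, of p "\<lambda>x. \<bar>1 - R x\<bar>"] by (simp add: ex_R power2_commute)
  also have "cube_ex p E (\<lambda>x. (R x - cube_ex p E R)\<^sup>2) = (p * (1 - p) / s2)\<^sup>2 *
      (cube_ex p E (\<lambda>x. (\<Sum>e\<in>E. G e x)\<^sup>2) - (cube_ex p E (\<lambda>x. \<Sum>e\<in>E. G e x))\<^sup>2)"
  proof -
    have R: "R = (\<lambda>x. p * (1 - p) / s2 * (\<Sum>e\<in>E. G e x))" by (simp add: R_def [abs_def])
    show ?thesis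
      unfolding cube_ex_variance_eq[OF E] unfolding R power_mult_distrib cube_ex_cmult
      by (simp add: right_diff_distrib)
  qed
  also have "sqrt \<dots> = p * (1 - p) *
      sqrt (cube_ex p E (\<lambda>x. (\<Sum>e\<in>E. G e x)\<^sup>2) - (cube_ex p E (\<lambda>x. \<Sum>e\<in>E. G e x))\<^sup>2) / s2"
    using pq s2_pos p_gt_0 p_less_1 by (simp add: real_sqrt_mult)
  finally have part1: "\<bar>cube_ex p E (\<lambda>x. ?f' (W x) * (1 - R x))\<bar> \<le> p * (1 - p) *
      sqrt (cube_ex p E (\<lambda>x. (\<Sum>e\<in>E. G e x)\<^sup>2) - (cube_ex p E (\<lambda>x. \<Sum>e\<in>E. G e x))\<^sup>2) / s2" .

  have taylor: "\<bar>B e x * (discrete_diff e W x * ?f' (W x) - discrete_diff e (\<lambda>x. ?f (W x)) x)\<bar>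
      \<le> G e x / s * discrete_diff e (\<lambda>x. ?H (W x)) x" for e x
  proof -
    \<comment> \<open>The configuration \<open>x\<close> is one of its own two modifications at
      \<open>e\<close>, so \<open>W x\<close> is an endpoint of the interval, as
      \<open>stein_sol_taylor\<close> demands.\<close>
    have "x = x(e := True) \<or> x = x(e := False)" by (metis (full_types) fun_upd_triv)
    then have "W x = W (x(e := False)) \<or> W x = W (x(e := True))" by metis
    moreover have "W (x(e := False)) \<le> W (x(e := True))"
      using T_mono[of e x] s by (simp add: W_def discrete_diff_def divide_right_mono)
    ultimately have "\<bar>discrete_diff e W x * ?f' (W x) - discrete_diff e (\<lambda>x. ?f (W x)) x\<bar>
      \<le> discrete_diff e W x * discrete_diff e (\<lambda>x. ?H (W x)) x"
      unfolding discrete_diff_def by (intro stein_sol_taylor)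
    from mult_left_mono[OF this B_nonneg[of e x]] show ?thesis
      by (simp add: abs_mult B_nonneg G_def W_diff)
  qed
  have "cube_ex p E (\<lambda>x. W x * ?f (W x)) = cube_ex p E (\<lambda>x. (T x - \<mu>) * ?f (W x)) / s"
    by (simp add: W_def flip: cube_ex_divide)
  also have "\<dots> = p * (1 - p) / s * (\<Sum>e\<in>E. cube_ex p E (\<lambda>x. B e x * discrete_diff e (\<lambda>x. ?f (W x)) x))"
    by (simp add: ibp)
  finally have ex_Wf: "cube_ex p E (\<lambda>x. W x * ?f (W x)) =
      p * (1 - p) / s * (\<Sum>e\<in>E. cube_ex p E (\<lambda>x. B e x * discrete_diff e (\<lambda>x. ?f (W x)) x))" .
  have "cube_ex p E (\<lambda>x. ?f' (W x) * R x) - cube_ex p E (\<lambda>x. W x * ?f (W x)) =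
      p * (1 - p) / s * (\<Sum>e\<in>E. cube_ex p E (\<lambda>x. B e x *
        (discrete_diff e W x * ?f' (W x) - discrete_diff e (\<lambda>x. ?f (W x)) x)))"
    (is "?L = _ * (\<Sum>e\<in>E. ?D e)")
  proof -
    have "cube_ex p E (\<lambda>x. ?f' (W x) * R x) = p * (1 - p) / s *
        (\<Sum>e\<in>E. cube_ex p E (\<lambda>x. B e x * (discrete_diff e W x * ?f' (W x))))"
      unfolding lin[symmetric] cube_ex_cmult[symmetric]
      by (simp add: R_def W_diff G_def s(3)[symmetric] sum_distrib_left sum_distrib_right
          sum_divide_distrib mult_ac)
    then show ?thesis
      by (simp add: ex_Wf right_diff_distrib lin sum_subtractf)
  qed
  also have "\<bar>\<dots>\<bar> \<le> p * (1 - p) / s * (\<Sum>e\<in>E. \<bar>?D e\<bar>)"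
  proof -
    have "0 \<le> p * (1 - p) / s" using pq s by simp
    then show ?thesis
      unfolding abs_mult [of "p * (1 - p) / s"] abs_of_nonneg [OF \<open>0 \<le> p * (1 - p) / s\<close>]
      by (intro mult_left_mono sum_abs)
  qed
  also have "\<dots> \<le> p * (1 - p) / s * (\<Sum>e\<in>E. cube_ex p E (\<lambda>x. G e x / s * discrete_diff e (\<lambda>x. ?H (W x)) x))"
    using pq s
    by (intro mult_left_mono sum_mono order_trans[OF abs_cube_ex_le] cube_ex_mono E taylor) simp
  also have "\<dots> = (\<Sum>e\<in>E. p * (1 - p) * cube_ex p E (\<lambda>x. G e x * discrete_diff e (\<lambda>x. ?H (W x)) x)) / s2"
    by (simp add: sum_distrib_left sum_divide_distrib cube_ex_divide flip: s(3))
  \<comment> \<open>Integration by parts read backwards: \<open>G e\<close> ignores coordinate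
    \<open>e\<close> and may be moved into the difference. The increments of \<open>?H\<close> have
    become \<open>?H\<close> itself, which is bounded by 2.\<close>
  also have "\<dots> = (\<Sum>e\<in>E. cube_ex p E (\<lambda>x. (of_bool (x e) - p) * (G e x * ?H (W x)))) / s2"
    by (intro arg_cong2[where f = divide] sum.cong refl, subst cube_ex_centered[OF E])
      (simp_all add: discrete_diff_def [abs_def] G_upd right_diff_distrib)
  also have "\<dots> = cube_ex p E (\<lambda>x. ?H (W x) * Y x) / s2"
    unfolding lin[symmetric] by (simp add: Y_def sum_distrib_left mult_ac)
  also have "\<dots> \<le> cube_ex p E (\<lambda>x. 2 * \<bar>Y x\<bar>) / s2"
  proof (intro divide_right_mono cube_ex_mono E)
    fix x
    have "?H (W x) * Y x \<le> \<bar>?H (W x)\<bar> * \<bar>Y x\<bar>"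
      by (simp flip: abs_mult)
    also have "\<dots> \<le> 2 * \<bar>Y x\<bar>"
      by (intro mult_right_mono abs_stein_monotone_le) simp
    finally show "?H (W x) * Y x \<le> 2 * \<bar>Y x\<bar>" .
  qed (use s2_pos in simp)
  also have "\<dots> \<le> 2 * sqrt (cube_ex p E (\<lambda>x. (Y x)\<^sup>2)) / s2"
    using cube_ex_le_sqrt[OF E, of p "\<lambda>x. \<bar>Y x\<bar>"] s2_pos by (simp add: divide_right_mono)
  finally have part2: "\<bar>?L\<bar> \<le> 2 * sqrt (cube_ex p E (\<lambda>x. (Y x)\<^sup>2)) / s2" .
  have "\<bar>cube_ex p E (\<lambda>x. of_bool (W x \<le> z)) - cdf std_normal_distribution z\<bar> \<le>
      \<bar>cube_ex p E (\<lambda>x. ?f' (W x) * (1 - R x))\<bar> + \<bar>?L\<bar>"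
    unfolding main by (rule abs_triangle_ineq)
  also note add_mono[OF part1 part2]
  finally show ?bound
    unfolding W_def s_def Y_def by (simp add: add_divide_distrib)
qed

end

section \<open>Triangles and adjacent edges\<close>

definition pairs :: "'v set \<Rightarrow> 'v set set" where
  "pairs t = {e. e \<subseteq> t \<and> card e = 2}"

definition triples :: "'v set \<Rightarrow> 'v set set" where
  "triples V = {t. t \<subseteq> V \<and> card t = 3}"

definition triples_at :: "'v set \<Rightarrow> 'v set \<Rightarrow> 'v set set" where
  "triples_at V e = {t \<in> triples V. e \<subseteq> t}"

text \<open>For two sides of a triangle the symmetric difference is the remaining side.\<close>

definition third_edge :: "'v set \<Rightarrow> 'v set \<Rightarrow> 'v set" where
  "third_edge e e' = (e - e') \<union> (e' - e)"

text \<open>For two-element sets, a union of size three means exactly one common vertex; in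
  particular an edge is not adjacent to itself.\<close>

definition adjacent :: "'v set \<Rightarrow> 'v set \<Rightarrow> bool" where
  "adjacent e e' \<longleftrightarrow> card (e \<union> e') = 3"

lemma finite_pairs: "finite t \<Longrightarrow> finite (pairs t)"
  by (rule finite_subset[of _ "Pow t"]) (auto simp: pairs_def)

lemma finite_triples: "finite V \<Longrightarrow> finite (triples V)"
  by (rule finite_subset[of _ "Pow V"]) (auto simp: triples_def)

lemma finite_triples_at: "finite V \<Longrightarrow> finite (triples_at V e)"
  by (simp add: triples_at_def finite_triples)

lemma adjacent_sym: "adjacent e e' \<longleftrightarrow> adjacent e' e"
  by (simp add: adjacent_def Un_commute)

lemma third_edge_sym: "third_edge e e' = third_edge e' e"
  by (auto simp: third_edge_def)

text \<open>A symmetric difference with \<open>e\<close> fixed determines its other argument. This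
  limits the coincidences of third edges in \<open>gram_variance_le\<close>.\<close>

lemma third_edge_inj: "third_edge e e1 = third_edge e e2 \<Longrightarrow> e1 = e2"
  unfolding third_edge_def by blast

lemma pairs_triple:
  assumes "a \<noteq> b" "a \<noteq> c" "b \<noteq> c"
  shows "pairs {a, b, c} = {{a, b}, {a, c}, {b, c}}"
proof
  show "pairs {a, b, c} \<subseteq> {{a, b}, {a, c}, {b, c}}"
  proof
    fix e assume "e \<in> pairs {a, b, c}"
    then obtain u v where "e = {u, v}" "u \<noteq> v" "e \<subseteq> {a, b, c}"
      by (auto simp: pairs_def card_2_iff)
    then show "e \<in> {{a, b}, {a, c}, {b, c}}" by auto
  qed
qed (use assms in \<open>auto simp: pairs_def\<close>)

lemma adjacentE:
  assumes "card e = 2" "card e' = 2" "adjacent e e'"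
  obtains a b c where "e = {a, b}" "e' = {a, c}" "a \<noteq> b" "a \<noteq> c" "b \<noteq> c"
proof -
  have fin: "finite e" "finite e'" using assms by (auto intro: card_ge_0_finite)
  have "card (e \<inter> e') = 1"
    using card_Un_Int[OF fin] assms by (simp add: adjacent_def)
  then obtain a where a: "e \<inter> e' = {a}" by (auto simp: card_1_singleton_iff)
  have "card (e - {a}) = 1" "card (e' - {a}) = 1"
    using assms a by (auto simp: card_Diff_singleton_if)
  then obtain b c where "e - {a} = {b}" "e' - {a} = {c}"
    by (auto simp: card_1_singleton_iff)
  then show ?thesis
    using a by (intro that[of a b c]) blast+
qed

lemma pairs_Un_adjacent:
  assumes "card e = 2" "card e' = 2" "adjacent e e'"
  shows "pairs (e \<union> e') - {e} = {e', third_edge e e'}" "third_edge e e' \<noteq> e'" "third_edge e e' \<noteq> e"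
    "card (third_edge e e') = 2"
proof -
  obtain a b c where abc: "e = {a, b}" "e' = {a, c}" "a \<noteq> b" "a \<noteq> c" "b \<noteq> c"
    using assms by (rule adjacentE)
  have third: "third_edge e e' = {b, c}"
    using abc by (auto simp: third_edge_def)
  have "e \<union> e' = {a, b, c}" using abc by auto
  with abc third pairs_triple[of a b c] show "pairs (e \<union> e') - {e} = {e', third_edge e e'}"
    by (auto simp: doubleton_eq_iff)
  show "third_edge e e' \<noteq> e'" "third_edge e e' \<noteq> e" "card (third_edge e e') = 2"
    using abc third by (auto simp: doubleton_eq_iff)
qed

text \<open>Two distinct pairs inside a triple already cover it. Hence switching one other edge
  affects at most one triangle at \<open>e\<close>, which keeps all later influences local.\<close>

lemma triples_at_eq_Un:
  assumes "t \<in> triples_at V e" "f \<in> pairs t" "f \<noteq> e" "card e = 2"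
  shows "t = e \<union> f" "adjacent e f"
proof -
  have t: "card t = 3" "e \<subseteq> t" "f \<subseteq> t" "card f = 2"
    using assms by (auto simp: triples_at_def triples_def pairs_def)
  have fin: "finite t" using t(1) by (auto intro: card_ge_0_finite)
  have "e \<union> f \<subseteq> t" using t by auto
  moreover have "card (e \<union> f) > 2"
  proof (rule ccontr)
    assume "\<not> card (e \<union> f) > 2"
    then have "e = e \<union> f" "f = e \<union> f"
      using fin t assms(4) by (intro card_seteq; auto dest: finite_subset)+
    with assms(3) show False by simp
  qed
  ultimately show "t = e \<union> f"
    using t fin by (metis card_seteq Suc_leI eval_nat_numeral(3))
  then show "adjacent e f" using t by (simp add: adjacent_def)
qed

lemma triples_atE:
  assumes "t \<in> triples_at V e" "card e = 2"
  obtains f g where "pairs t - {e} = {f, g}" "pairs t = {e, f, g}" "f \<noteq> g" "f \<noteq> e" "g \<noteq> e"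
    "f \<in> pairs V" "g \<in> pairs V"
proof -
  have t: "card t = 3" "e \<subseteq> t" "t \<subseteq> V"
    using assms by (auto simp: triples_at_def triples_def)
  then have fin: "finite t" by (auto intro: card_ge_0_finite)
  obtain a b where e: "e = {a, b}" "a \<noteq> b" using assms(2) by (auto simp: card_2_iff)
  have "card (t - e) = 1" using card_Diff_subset[of e t] t fin assms(2) finite_subset by fastforce
  then obtain c where "t - e = {c}" by (auto simp: card_1_singleton_iff)
  with t e have abc: "t = {a, b, c}" "c \<noteq> a" "c \<noteq> b" by auto
  have pairs: "pairs t = {e, {a, c}, {b, c}}"
    using pairs_triple[of a b c] abc e by auto
  have neq: "{a, c} \<noteq> {b, c}" "{a, c} \<noteq> e" "{b, c} \<noteq> e"
    using abc e by (auto simp: doubleton_eq_iff)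
  show ?thesis
  proof (rule that)
    show "pairs t - {e} = {{a, c}, {b, c}}" using pairs neq by auto
    show "{a, c} \<in> pairs V" "{b, c} \<in> pairs V" using abc t by (auto simp: pairs_def)
  qed (rule pairs neq)+
qed

lemma card_triples_at:
  assumes "finite V" "e \<in> pairs V"
  shows "card (triples_at V e) = card V - 2"
proof -
  have e: "e \<subseteq> V" "card e = 2" "finite e"
    using assms finite_subset by (auto simp: pairs_def)
  have "bij_betw (\<lambda>v. insert v e) (V - e) (triples_at V e)"
    unfolding bij_betw_def
  proof
    show "inj_on (\<lambda>v. insert v e) (V - e)"
      by (auto simp: inj_on_def)
    show "(\<lambda>v. insert v e) ` (V - e) = triples_at V e"
    proof
      show "(\<lambda>v. insert v e) ` (V - e) \<subseteq> triples_at V e"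
        using e by (auto simp: triples_at_def triples_def)
      show "triples_at V e \<subseteq> (\<lambda>v. insert v e) ` (V - e)"
      proof
        fix t assume "t \<in> triples_at V e"
        then have t: "card t = 3" "e \<subseteq> t" "t \<subseteq> V" by (auto simp: triples_at_def triples_def)
        then have "card (t - e) = 1" using e by (simp add: card_Diff_subset)
        then obtain v where "t - e = {v}" by (auto simp: card_1_singleton_iff)
        with t show "t \<in> (\<lambda>v. insert v e) ` (V - e)" by (intro image_eqI[of _ _ v]) auto
      qed
    qed
  qed
  from bij_betw_same_card[OF this] show ?thesis
    using e assms by (simp add: card_Diff_subset)
qed

text \<open>An adjacent edge is fixed by the shared vertex, one of two, and by its other end;
  overcounting is harmless.\<close>

lemma card_adjacent_le:
  assumes "finite V" "e \<in> pairs V"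
  shows "card {e' \<in> pairs V. adjacent e e'} \<le> 2 * card V"
proof -
  have e: "card e = 2" "finite e" using assms finite_subset by (auto simp: pairs_def)
  have "{e' \<in> pairs V. adjacent e e'} \<subseteq> (\<lambda>(a, v). {a, v}) ` (e \<times> V)"
  proof
    fix e' assume e': "e' \<in> {e' \<in> pairs V. adjacent e e'}"
    then obtain a b c where "e = {a, b}" "e' = {a, c}"
      using adjacentE[of e e' thesis] e by (auto simp: pairs_def)
    with e' show "e' \<in> (\<lambda>(a, v). {a, v}) ` (e \<times> V)"
      by (auto simp: pairs_def intro!: image_eqI[of _ _ "(a, c)"])
  qed
  then have "card {e' \<in> pairs V. adjacent e e'} \<le> card ((\<lambda>(a, v). {a, v}) ` (e \<times> V))"
    using assms e by (intro card_mono) auto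
  also have "\<dots> \<le> card (e \<times> V)" using assms e by (intro card_image_le) auto
  finally show ?thesis using e by (simp add: card_cartesian_product)
qed

lemma card_pairs: "finite V \<Longrightarrow> card (pairs V) = card V choose 2"
  unfolding pairs_def by (rule n_subsets)

lemma card_pairs_real: "finite V \<Longrightarrow> real (card (pairs V)) = real (card V) * (real (card V) - 1) / 2"
proof (cases "card V")
  case (Suc m)
  moreover have "even (card V * (card V - 1))" using Suc by simp
  ultimately show "finite V \<Longrightarrow> ?thesis"
    by (simp add: card_pairs choose_two real_of_nat_div algebra_simps)
qed (simp add: card_pairs)


text \<open>Averaging the telescoping identity for \<open>a * b * c - p ^ 3\<close> over the six orders of the three
  factors gives the coefficients \<open>1/3\<close>, \<open>p/6\<close> and \<open>p\<^sup>2/3\<close> of \<open>tri_coeff\<close>.\<close>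

lemma prod_telescope_symmetric:
  fixes a b c p :: real
  shows "a * b * c - p ^ 3 =
    (a - p) * (b * c / 3 + p / 6 * (b + c) + p\<^sup>2 / 3) +
    (b - p) * (a * c / 3 + p / 6 * (a + c) + p\<^sup>2 / 3) +
    (c - p) * (a * b / 3 + p / 6 * (a + b) + p\<^sup>2 / 3)"
  by (simp add: field_simps power2_eq_square power3_eq_cube)

section \<open>Edgewise decomposition of the triangle count\<close>

locale triangle_cube = bernoulli_cube p for p +
  fixes V :: "'v set"
  assumes finite_V: "finite V"
begin

definition prod_on :: "'v set set \<Rightarrow> ('v set \<Rightarrow> bool) \<Rightarrow> real" where
  "prod_on A x = (\<Prod>f\<in>A. of_bool (x f))"

text \<open>When \<open>A\<close> consists of the two remaining sides of a triangle, this is the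
  factor from \<open>prod_telescope_symmetric\<close>.\<close>

definition coeff_on :: "'v set set \<Rightarrow> ('v set \<Rightarrow> bool) \<Rightarrow> real" where
  "coeff_on A x = prod_on A x / 3 + p / 6 * (\<Sum>f\<in>A. of_bool (x f)) + p\<^sup>2 / 3"

lemma prod_on_upd [simp]: "f \<notin> A \<Longrightarrow> prod_on A (x(f := b)) = prod_on A x"
  unfolding prod_on_def by (intro prod.cong) auto

lemma coeff_on_upd [simp]: "f \<notin> A \<Longrightarrow> coeff_on A (x(f := b)) = coeff_on A x"
  unfolding coeff_on_def
  by (intro arg_cong2[where f = plus] arg_cong2[where f = times] sum.cong refl) auto

lemma prod_on_insert: "finite A \<Longrightarrow> f \<notin> A \<Longrightarrow> prod_on (insert f A) x = of_bool (x f) * prod_on A x"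
  by (simp add: prod_on_def)

lemma prod_on_2: "f \<noteq> g \<Longrightarrow> prod_on {f, g} x = of_bool (x f) * of_bool (x g)"
  by (simp add: prod_on_def)

lemma coeff_on_2:
  "f \<noteq> g \<Longrightarrow> coeff_on {f, g} x =
    of_bool (x f) * of_bool (x g) / 3 + p / 6 * (of_bool (x f) + of_bool (x g)) + p\<^sup>2 / 3"
  by (simp add: coeff_on_def prod_on_2 del: sum_of_bool_eq)

lemma prod_on_nonneg: "0 \<le> prod_on A x"
  unfolding prod_on_def by (intro prod_nonneg) auto

lemma coeff_on_nonneg: "0 \<le> coeff_on A x"
  unfolding coeff_on_def using p_gt_0
  by (intro add_nonneg_nonneg mult_nonneg_nonneg divide_nonneg_nonneg prod_on_nonneg sum_nonneg) auto

definition tri :: "('v set \<Rightarrow> bool) \<Rightarrow> real" where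
  "tri x = (\<Sum>t\<in>triples V. prod_on (pairs t) x)"

definition tri_deriv :: "'v set \<Rightarrow> ('v set \<Rightarrow> bool) \<Rightarrow> real" where
  "tri_deriv e x = (\<Sum>t\<in>triples_at V e. prod_on (pairs t - {e}) x)"

text \<open>This is \<open>B\<^sub>e\<close> of the overview, and \<open>tri_deriv e\<close> is
  \<open>D\<^sub>e\<close>.\<close>

definition tri_coeff :: "'v set \<Rightarrow> ('v set \<Rightarrow> bool) \<Rightarrow> real" where
  "tri_coeff e x = (\<Sum>t\<in>triples_at V e. coeff_on (pairs t - {e}) x)"

text \<open>A common majorant of \<open>tri_coeff\<close> and \<open>tri_deriv\<close>. Its summands
  are products of two increasing factors of mean 2p, which makes its moments accessible by a
  recursion.\<close>

definition envelope :: "'v set \<Rightarrow> ('v set \<Rightarrow> bool) \<Rightarrow> real" where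
  "envelope e x = (\<Sum>t\<in>triples_at V e. \<Prod>f\<in>pairs t - {e}. (of_bool (x f) + p))"

lemma finite_E: "finite (pairs V)"
  by (rule finite_pairs[OF finite_V])

lemma finite_pairs_triple: "t \<in> triples V \<Longrightarrow> finite (pairs t)"
  using finite_V finite_subset by (auto simp: triples_def intro!: finite_pairs)

lemma discrete_diff_tri: "e \<in> pairs V \<Longrightarrow> discrete_diff e tri = tri_deriv e"
proof
  fix x
  assume e: "e \<in> pairs V"
  have "discrete_diff e tri x =
      (\<Sum>t\<in>triples V. prod_on (pairs t) (x(e := True)) - prod_on (pairs t) (x(e := False)))"
    by (simp add: discrete_diff_def tri_def sum_subtractf)
  also have "\<dots> = (\<Sum>t\<in>triples V. if e \<subseteq> t then prod_on (pairs t - {e}) x else 0)"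
  proof (rule sum.cong)
    fix t assume t: "t \<in> triples V"
    show "prod_on (pairs t) (x(e := True)) - prod_on (pairs t) (x(e := False)) =
      (if e \<subseteq> t then prod_on (pairs t - {e}) x else 0)"
    proof (cases "e \<subseteq> t")
      case True
      then have "pairs t = insert e (pairs t - {e})" using e by (auto simp: pairs_def)
      then have "prod_on (pairs t) y = of_bool (y e) * prod_on (pairs t - {e}) y" for y
        using finite_pairs_triple[OF t] by (metis Diff_iff finite_Diff insertI1 prod_on_insert)
      then show ?thesis using True by simp
    next
      case False
      then have "e \<notin> pairs t" by (simp add: pairs_def)
      with False show ?thesis by simp
    qed
  qed simp
  also have "\<dots> = tri_deriv e x"
    using finite_triples[OF finite_V] by (simp add: tri_deriv_def triples_at_def sum.If_cases Int_def)
  finally show "discrete_diff e tri x = tri_deriv e x" .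
qed

lemma discrete_diff_tri_nonneg: "0 \<le> discrete_diff e tri x"
  unfolding discrete_diff_def tri_def prod_on_def
  by (simp, intro sum_mono prod_mono) auto

lemma tri_coeff_upd [simp]: "tri_coeff e (x(e := b)) = tri_coeff e x"
  by (simp add: tri_coeff_def)

lemma tri_deriv_upd [simp]: "tri_deriv e (x(e := b)) = tri_deriv e x"
  by (simp add: tri_deriv_def)

lemma tri_coeff_nonneg: "0 \<le> tri_coeff e x"
  unfolding tri_coeff_def by (intro sum_nonneg coeff_on_nonneg)

lemma tri_deriv_nonneg: "0 \<le> tri_deriv e x"
  unfolding tri_deriv_def by (intro sum_nonneg prod_on_nonneg)

lemma envelope_nonneg: "0 \<le> envelope e x"
  unfolding envelope_def using p_gt_0 by (intro sum_nonneg prod_nonneg) auto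

text \<open>Exchanging the sums over edges and triples leaves one telescoping identity per
  triple.\<close>

lemma tri_expansion:
  "tri x - card (triples V) * p ^ 3 = (\<Sum>e\<in>pairs V. (of_bool (x e) - p) * tri_coeff e x)"
proof -
  define F :: "'v set \<Rightarrow> 'v set \<Rightarrow> real" where "F e t = (of_bool (x e) - p) * coeff_on (pairs t - {e}) x" for e t
  have "(\<Sum>e\<in>pairs V. (of_bool (x e) - p) * tri_coeff e x) = (\<Sum>e\<in>pairs V. \<Sum>t\<in>triples_at V e. F e t)"
    by (simp add: tri_coeff_def F_def sum_distrib_left)
  also have "\<dots> = (\<Sum>t\<in>triples V. \<Sum>e | e \<in> pairs V \<and> e \<subseteq> t. F e t)"
    unfolding triples_at_def by (rule sum.swap_restrict[OF finite_E finite_triples[OF finite_V]])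
  also have "\<dots> = (\<Sum>t\<in>triples V. prod_on (pairs t) x - p ^ 3)"
  proof (rule sum.cong)
    fix t assume t: "t \<in> triples V"
    then obtain a b c where abc: "t = {a, b, c}" "a \<noteq> b" "a \<noteq> c" "b \<noteq> c"
      by (auto simp: triples_def card_3_iff)
    define e f g where "e = {a, b}" and "f = {a, c}" and "g = {b, c}"
    have neq: "e \<noteq> f" "e \<noteq> g" "f \<noteq> g"
      using abc by (auto simp: e_def f_def g_def doubleton_eq_iff)
    have P: "pairs t = {e, f, g}"
      using abc by (simp add: pairs_triple e_def f_def g_def)
    have "{e \<in> pairs V. e \<subseteq> t} = pairs t"
      using t by (auto simp: pairs_def triples_def)
    moreover have "pairs t - {e} = {f, g}" "pairs t - {f} = {e, g}" "pairs t - {g} = {e, f}"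
      using P neq by auto
    ultimately have "(\<Sum>e | e \<in> pairs V \<and> e \<subseteq> t. F e t) =
        (of_bool (x e) - p) * (of_bool (x f) * of_bool (x g) / 3 + p / 6 * (of_bool (x f) + of_bool (x g)) + p\<^sup>2 / 3) +
        (of_bool (x f) - p) * (of_bool (x e) * of_bool (x g) / 3 + p / 6 * (of_bool (x e) + of_bool (x g)) + p\<^sup>2 / 3) +
        (of_bool (x g) - p) * (of_bool (x e) * of_bool (x f) / 3 + p / 6 * (of_bool (x e) + of_bool (x f)) + p\<^sup>2 / 3)"
      using neq by (simp add: P F_def coeff_on_2)
    also have "\<dots> = of_bool (x e) * of_bool (x f) * of_bool (x g) - p ^ 3"
      by (rule prod_telescope_symmetric[symmetric])
    also have "\<dots> = prod_on (pairs t) x - p ^ 3"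
      using neq by (simp add: P prod_on_def)
    finally show "(\<Sum>e | e \<in> pairs V \<and> e \<subseteq> t. F e t) = prod_on (pairs t) x - p ^ 3" .
  qed simp
  also have "\<dots> = tri x - card (triples V) * p ^ 3"
    by (simp add: tri_def sum_subtractf)
  finally show ?thesis by simp
qed

lemma tri_deriv_le_envelope: "tri_deriv e x \<le> envelope e x"
  unfolding tri_deriv_def envelope_def prod_on_def using p_gt_0 by (intro sum_mono prod_mono) auto

text \<open>Expanding (x_f + p) (x_g + p) gives the monomials of \<open>coeff_on\<close> with larger
  coefficients.\<close>

lemma tri_coeff_le_envelope:
  assumes "e \<in> pairs V"
  shows "tri_coeff e x \<le> envelope e x"
  unfolding tri_coeff_def envelope_def
proof (rule sum_mono)
  fix t assume t: "t \<in> triples_at V e"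
  have "card e = 2" using assms by (simp add: pairs_def)
  with t obtain f g where fg: "pairs t - {e} = {f, g}" "f \<noteq> g" by (rule triples_atE)
  have "p * (of_bool (x f) + of_bool (x g)) \<ge> 0" "p\<^sup>2 \<ge> 0" "of_bool (x f) * of_bool (x g) \<ge> (0 :: real)"
    using p_gt_0 by auto
  then have "of_bool (x f) * of_bool (x g) / 3 + p / 6 * (of_bool (x f) + of_bool (x g)) + p\<^sup>2 / 3
      \<le> of_bool (x f) * of_bool (x g) + p * (of_bool (x f) + of_bool (x g)) + p\<^sup>2"
    by linarith
  also have "\<dots> = (of_bool (x f) + p) * (of_bool (x g) + p)"
    by (simp add: algebra_simps power2_eq_square)
  finally show "coeff_on (pairs t - {e}) x
      \<le> (\<Prod>f\<in>pairs t - {e}. of_bool (x f) + p)"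
    using fg by (simp add: coeff_on_2)
qed

lemma envelope_mono: "mono (envelope e)"
  unfolding envelope_def using p_gt_0
  by (intro monoI sum_mono prod_mono) (auto simp: le_fun_def)

text \<open>Only the triple \<open>e \<union> f\<close> can feel \<open>f\<close>; its product is
  nonnegative and at most 2 * 2.\<close>

lemma envelope_upd_le:
  assumes "e \<in> pairs V"
  shows "envelope e (x(f := b)) \<le> envelope e x + 4"
proof -
  have e: "card e = 2" using assms by (simp add: pairs_def)
  have "envelope e (x(f := b)) - envelope e x = (\<Sum>t\<in>triples_at V e.
      (\<Prod>f'\<in>pairs t - {e}. of_bool ((x(f := b)) f') + p) - (\<Prod>f'\<in>pairs t - {e}. of_bool (x f') + p))"
    by (simp add: envelope_def sum_subtractf)
  also have "\<dots> \<le> (\<Sum>t\<in>triples_at V e. if t = e \<union> f then 4 else 0)"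
  proof (rule sum_mono)
    fix t assume t: "t \<in> triples_at V e"
    from t e obtain g h where gh: "pairs t - {e} = {g, h}" "g \<noteq> h" by (rule triples_atE)
    let ?d = "(\<Prod>f'\<in>pairs t - {e}. of_bool ((x(f := b)) f') + p) - (\<Prod>f'\<in>pairs t - {e}. of_bool (x f') + p)"
    show "?d \<le> (if t = e \<union> f then 4 else 0)"
    proof (cases "f \<in> pairs t - {e}")
      case True
      then have "t = e \<union> f" using triples_at_eq_Un[OF t _ _ e] by auto
      moreover have "(\<Prod>f'\<in>pairs t - {e}. of_bool ((x(f := b)) f') + p) \<le> (\<Prod>f'\<in>pairs t - {e}. 2)"
        using p_gt_0 p_less_1 by (intro prod_mono) auto
      moreover have "(\<Prod>f'\<in>pairs t - {e}. of_bool (x f') + p) \<ge> 0"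
        using p_gt_0 by (intro prod_nonneg) auto
      ultimately show ?thesis using gh by simp
    next
      case False
      then have "(x(f := b)) f' = x f'" if "f' \<in> pairs t - {e}" for f' using that by auto
      then show ?thesis by simp
    qed
  qed
  also have "\<dots> \<le> 4"
    using finite_triples_at[OF finite_V] by (simp add: sum.delta)
  finally show ?thesis by simp
qed

lemma discrete_diff_sum:
  "discrete_diff e (\<lambda>x. \<Sum>i\<in>I. g i x) x = (\<Sum>i\<in>I. discrete_diff e (g i) x)"
  by (simp add: discrete_diff_def sum_subtractf)

text \<open>The summand \<open>F\<close> is generic so that one statement serves
  \<open>prod_on\<close> and \<open>coeff_on\<close>. All triples except \<open>e \<union> f\<close>
  cancel, and the sides of that one besides \<open>e\<close> are \<open>f\<close> and the third
  edge.\<close>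

lemma discrete_diff_triples:
  assumes "e \<in> pairs V" "f \<in> pairs V" "e \<noteq> f" and adj: "adjacent e f"
    and F: "\<And>A x b. f \<notin> A \<Longrightarrow> F A (x(f := b)) = F A x"
  shows "discrete_diff f (\<lambda>x. \<Sum>t\<in>triples_at V e. F (pairs t - {e}) x) x = discrete_diff f (F {f, third_edge e f}) x"
proof -
  have e: "card e = 2" and f: "card f = 2" using assms by (auto simp: pairs_def)
  have t: "e \<union> f \<in> triples_at V e"
    using assms by (auto simp: triples_at_def triples_def adjacent_def pairs_def)
  have "discrete_diff f (F (pairs t - {e})) x = 0" if "t \<in> triples_at V e - {e \<union> f}" for t
  proof -
    have "f \<notin> pairs t - {e}" using triples_at_eq_Un[of t V e f] that e by auto
    then show ?thesis by (simp add: discrete_diff_def F)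
  qed
  then show ?thesis
    unfolding discrete_diff_sum
    by (subst sum.remove[OF finite_triples_at[OF finite_V] t])
      (simp add: pairs_Un_adjacent(1)[OF e f adj])
qed

lemma discrete_diff_triples_nonadjacent:
  assumes "e \<in> pairs V" "e \<noteq> f" and adj: "\<not> adjacent e f"
    and F: "\<And>A x b. f \<notin> A \<Longrightarrow> F A (x(f := b)) = F A x"
  shows "discrete_diff f (\<lambda>x. \<Sum>t\<in>triples_at V e. F (pairs t - {e}) x) x = 0"
  unfolding discrete_diff_sum
proof (intro sum.neutral ballI)
  fix t assume t: "t \<in> triples_at V e"
  have "card e = 2" using assms by (auto simp: pairs_def)
  with t assms have "f \<notin> pairs t - {e}" using triples_at_eq_Un[of t V e f] by auto
  then show "discrete_diff f (F (pairs t - {e})) x = 0" by (simp add: discrete_diff_def F)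
qed

section \<open>Products of coefficient and increment, and their differences\<close>

text \<open>This is \<open>G\<^sub>e\<close> of the overview.\<close>

definition gram :: "'v set \<Rightarrow> ('v set \<Rightarrow> bool) \<Rightarrow> real" where
  "gram e x = tri_coeff e x * tri_deriv e x"

lemma gram_upd [simp]: "gram e (x(e := b)) = gram e x"
  by (simp add: gram_def)

lemma gram_nonneg: "0 \<le> gram e x"
  by (simp add: gram_def tri_coeff_nonneg tri_deriv_nonneg)

lemma discrete_diff_gram_nonadjacent:
  assumes "e \<in> pairs V" "\<not> adjacent e f"
  shows "discrete_diff f (gram e) x = 0"
proof (cases "e = f")
  case False
  note * = discrete_diff_triples_nonadjacent[OF assms(1) False assms(2)]
  have "discrete_diff f (tri_coeff e) x = 0" "discrete_diff f (tri_deriv e) x = 0"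
    unfolding tri_coeff_def [abs_def] tri_deriv_def [abs_def]
    by (rule *[where F = coeff_on, OF coeff_on_upd], simp, rule *[where F = prod_on, OF prod_on_upd], simp)
  then show ?thesis by (simp add: discrete_diff_def gram_def)
qed (simp add: discrete_diff_def)

text \<open>Product rule: each of the two factors changes by at most x_g + p, where g is the third
  edge, and the other factor, taken after an update at \<open>f\<close>, is at most the envelope
  plus 4.\<close>

lemma discrete_diff_gram:
  assumes "e \<in> pairs V" "f \<in> pairs V" "adjacent e f"
  shows "0 \<le> discrete_diff f (gram e) x"
    and "discrete_diff f (gram e) x \<le> 2 * (of_bool (x (third_edge e f)) + p) * (envelope e x + 4)"
proof -
  let ?g = "third_edge e f"
  have ef: "card e = 2" "card f = 2" using assms by (auto simp: pairs_def)
  then have neq: "e \<noteq> f" "?g \<noteq> f"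
    using assms pairs_Un_adjacent(2)[of e f] by (auto simp: adjacent_def)
  have dB: "discrete_diff f (tri_coeff e) x = of_bool (x ?g) / 3 + p / 6"
    unfolding tri_coeff_def [abs_def]
    by (subst discrete_diff_triples[OF assms(1,2) neq(1) assms(3)])
      (use neq in \<open>auto simp: discrete_diff_def coeff_on_2 algebra_simps\<close>)
  have dD: "discrete_diff f (tri_deriv e) x = of_bool (x ?g)"
    unfolding tri_deriv_def [abs_def]
    by (subst discrete_diff_triples[OF assms(1,2) neq(1) assms(3)])
      (use neq in \<open>auto simp: discrete_diff_def prod_on_2\<close>)
  have eq: "discrete_diff f (gram e) x =
      (of_bool (x ?g) / 3 + p / 6) * tri_deriv e (x(f := True)) + of_bool (x ?g) * tri_coeff e (x(f := False))"
  proof -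
    have "discrete_diff f (gram e) x = discrete_diff f (tri_coeff e) x * tri_deriv e (x(f := True)) +
        discrete_diff f (tri_deriv e) x * tri_coeff e (x(f := False))"
      by (simp add: discrete_diff_def gram_def algebra_simps)
    then show ?thesis by (simp only: dB dD)
  qed
  show "0 \<le> discrete_diff f (gram e) x"
    unfolding eq using p_gt_0
    by (intro add_nonneg_nonneg mult_nonneg_nonneg tri_deriv_nonneg tri_coeff_nonneg) auto
  have "discrete_diff f (gram e) x \<le> (of_bool (x ?g) + p) * (envelope e x + 4) + (of_bool (x ?g) + p) * (envelope e x + 4)"
    unfolding eq using p_gt_0
    by (intro add_mono mult_mono order_trans[OF tri_deriv_le_envelope envelope_upd_le]
        order_trans[OF tri_coeff_le_envelope envelope_upd_le] assms tri_deriv_nonneg tri_coeff_nonneg) auto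
  then show "discrete_diff f (gram e) x \<le> 2 * (of_bool (x ?g) + p) * (envelope e x + 4)"
    by (simp add: algebra_simps)
qed

end

section \<open>Moment bounds\<close>

context bernoulli_cube
begin

lemma cube_ex_of_bool_mult:
  assumes "finite E" "f \<in> E"
  shows "cube_ex p E (\<lambda>x. of_bool (x f) * h x) = p * cube_ex p E (\<lambda>x. h (x(f := True)))"
  by (subst cube_ex_split[OF assms]) simp

text \<open>The weight has mean 2p. As \<open>h\<close> is increasing, its value with
  \<open>f\<close> off may be replaced by the one with \<open>f\<close> on, after which the weight
  integrates separately.\<close>

lemma cube_ex_weight_le:
  assumes E: "finite E" "f \<in> E" and h: "mono h"
  shows "cube_ex p E (\<lambda>x. (of_bool (x f) + p) * h x) \<le> 2 * p * cube_ex p E (\<lambda>x. h (x(f := True)))"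
proof -
  let ?a = "cube_ex p E (\<lambda>x. h (x(f := True)))" and ?b = "cube_ex p E (\<lambda>x. h (x(f := False)))"
  have "?b \<le> ?a"
    by (intro cube_ex_mono E monoD[OF h]) (auto simp: le_fun_def)
  then have "(1 - p) * p * ?b \<le> (1 - p) * p * ?a"
    using p_gt_0 p_less_1 by (intro mult_left_mono) auto
  moreover have "cube_ex p E (\<lambda>x. (of_bool (x f) + p) * h x) = p * ((1 + p) * ?a) + (1 - p) * (p * ?b)"
    by (subst cube_ex_split[OF E]) simp
  ultimately show ?thesis by (simp add: algebra_simps)
qed

lemma cube_ex_weight2_le:
  assumes E: "finite E" "f \<in> E" "g \<in> E" "f \<noteq> g" and h: "mono h" "\<And>x. 0 \<le> h x"
  shows "cube_ex p E (\<lambda>x. (of_bool (x f) + p) * (of_bool (x g) + p) * h x)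
    \<le> 4 * p\<^sup>2 * cube_ex p E (\<lambda>x. h (x(f := True, g := True)))"
proof -
  have "mono (\<lambda>x. (of_bool (x g) + p) * h x)"
    using p_gt_0 h by (intro monoI mult_mono) (auto simp: le_fun_def monoD)
  from cube_ex_weight_le[OF E(1,2) this]
  have "cube_ex p E (\<lambda>x. (of_bool (x f) + p) * (of_bool (x g) + p) * h x)
    \<le> 2 * p * cube_ex p E (\<lambda>x. (of_bool (x g) + p) * h (x(f := True)))"
    using E(4) by (simp add: mult.assoc)
  also have "mono (\<lambda>x. h (x(f := True)))"
    by (intro monoI monoD[OF h(1)]) (auto simp: le_fun_def)
  from cube_ex_weight_le[OF E(1,3) this]
  have "2 * p * cube_ex p E (\<lambda>x. (of_bool (x g) + p) * h (x(f := True)))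
    \<le> 2 * p * (2 * p * cube_ex p E (\<lambda>x. h (x(g := True, f := True))))"
    using p_gt_0 by (intro mult_left_mono) auto
  finally show ?thesis
    using E(4) by (simp add: power2_eq_square fun_upd_twist mult.assoc)
qed

end

context triangle_cube
begin

abbreviation N :: real where "N \<equiv> real (card V)"

section \<open>Moments of the envelope\<close>

lemma card_triples_at_le: "e \<in> pairs V \<Longrightarrow> real (card (triples_at V e)) \<le> N"
  using card_triples_at[OF finite_V, of e] by simp

lemma envelope_upd2_le: "e \<in> pairs V \<Longrightarrow> envelope e (x(f := b, g := c)) \<le> envelope e x + 8"
  using envelope_upd_le[of e "x(f := b)" g c] envelope_upd_le[of e x f b] by linarith

text \<open>A size-biasing recursion: one factor of the power is expanded over triples, the two
  weights of a triple contribute at most 4 p^2 and force two edges on, and this raises the envelope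
  by at most 8.\<close>

lemma envelope_moment_le:
  assumes e: "e \<in> pairs V"
  shows "cube_ex p (pairs V) (\<lambda>x. envelope e x ^ Suc k) \<le>
    4 * N * p\<^sup>2 * cube_ex p (pairs V) (\<lambda>x. (envelope e x + 8) ^ k)"
proof -
  have mono: "mono (\<lambda>x. envelope e x ^ k)"
    by (intro monoI power_mono envelope_nonneg monoD[OF envelope_mono])
  have "cube_ex p (pairs V) (\<lambda>x. envelope e x ^ Suc k) =
      (\<Sum>t\<in>triples_at V e. cube_ex p (pairs V) (\<lambda>x. (\<Prod>f\<in>pairs t - {e}. of_bool (x f) + p) * envelope e x ^ k))"
    by (simp add: envelope_def sum_distrib_right cube_ex_sum[OF finite_E])
  also have "\<dots> \<le> (\<Sum>t\<in>triples_at V e. 4 * p\<^sup>2 * cube_ex p (pairs V) (\<lambda>x. (envelope e x + 8) ^ k))"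
  proof (rule sum_mono)
    fix t assume t: "t \<in> triples_at V e"
    have "card e = 2" using e by (simp add: pairs_def)
    with t obtain f g where fg: "pairs t - {e} = {f, g}" "f \<noteq> g" "f \<in> pairs V" "g \<in> pairs V"
      by (rule triples_atE)
    have "cube_ex p (pairs V) (\<lambda>x. (of_bool (x f) + p) * (of_bool (x g) + p) * envelope e x ^ k) \<le>
        4 * p\<^sup>2 * cube_ex p (pairs V) (\<lambda>x. envelope e (x(f := True, g := True)) ^ k)"
      by (rule cube_ex_weight2_le[OF finite_E fg(3,4,2) mono]) (simp add: envelope_nonneg)
    also have "\<dots> \<le> 4 * p\<^sup>2 * cube_ex p (pairs V) (\<lambda>x. (envelope e x + 8) ^ k)"
      by (intro mult_left_mono cube_ex_mono finite_E power_mono envelope_upd2_le e envelope_nonneg) auto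
    finally show "cube_ex p (pairs V) (\<lambda>x. (\<Prod>f\<in>pairs t - {e}. of_bool (x f) + p) * envelope e x ^ k) \<le>
        4 * p\<^sup>2 * cube_ex p (pairs V) (\<lambda>x. (envelope e x + 8) ^ k)"
      using fg by simp
  qed
  also have "\<dots> = card (triples_at V e) * (4 * p\<^sup>2 * cube_ex p (pairs V) (\<lambda>x. (envelope e x + 8) ^ k))"
    by simp
  also have "\<dots> \<le> N * (4 * p\<^sup>2 * cube_ex p (pairs V) (\<lambda>x. (envelope e x + 8) ^ k))"
    by (intro mult_right_mono card_triples_at_le e mult_nonneg_nonneg cube_ex_nonneg)
      (auto simp: envelope_nonneg)
  finally show ?thesis by (simp add: mult_ac)
qed

text \<open>The recursion is iterated with \<mu> = 4a. The shift 12 is the 4 of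
  \<open>discrete_diff_gram\<close> plus 8 for two forced edges. The bound on the fourth moment has
  no constant term, so it decays like a for sparse graphs.\<close>

lemma envelope_moments:
  assumes e: "e \<in> pairs V"
  defines "a \<equiv> N * p\<^sup>2"
  shows "cube_ex p (pairs V) (\<lambda>x. (envelope e x + 12)\<^sup>2) \<le> 208 * (1 + a\<^sup>2)"
    and "cube_ex p (pairs V) (\<lambda>x. envelope e x ^ 4) \<le> 13000 * (a + a ^ 4)"
proof -
  define m where "m k = cube_ex p (pairs V) (\<lambda>x. envelope e x ^ k)" for k
  define \<mu> where "\<mu> = 4 * a"
  have a: "a \<ge> 0" using p_gt_0 by (simp add: a_def)
  then have \<mu>: "\<mu> \<ge> 0" by (simp add: \<mu>_def)
  note lin = cube_ex_add[OF finite_E] cube_ex_diff[OF finite_E]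
  have m: "m j \<le> \<mu> * cube_ex p (pairs V) (\<lambda>x. (envelope e x + 8) ^ k)" if "j = Suc k" for j k
    using envelope_moment_le[OF e, of k] by (simp add: that m_def \<mu>_def a_def mult_ac)
  have eq2: "(envelope e x + 8) ^ 2 = envelope e x ^ 2 + 16 * envelope e x ^ 1 + 64"
    and eq3: "(envelope e x + 8) ^ 3 = envelope e x ^ 3 + 24 * envelope e x ^ 2 + 192 * envelope e x ^ 1 + 512"
    and eq4: "(envelope e x + 12)\<^sup>2 = envelope e x ^ 2 + 24 * envelope e x ^ 1 + 144" for x
    by (simp_all add: power2_eq_square power3_eq_cube algebra_simps)
  have m1: "m 1 \<le> \<mu>" using m[of 1 0] by simp
  have "m 2 \<le> \<mu> * (m 1 + 8)"
    using m[of 2 1] by (simp add: lin m_def)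
  also have "\<dots> \<le> \<mu> * (\<mu> + 8)" using m1 \<mu> by (intro mult_left_mono) auto
  finally have m2: "m 2 \<le> \<mu>\<^sup>2 + 8 * \<mu>" by (simp add: power2_eq_square algebra_simps)
  have "m 3 \<le> \<mu> * (m 2 + 16 * m 1 + 64)"
    using m[of 3 2] by (simp add: eq2 lin m_def)
  also have "\<dots> \<le> \<mu> * (\<mu>\<^sup>2 + 24 * \<mu> + 64)" using m1 m2 \<mu> by (intro mult_left_mono) auto
  finally have m3: "m 3 \<le> \<mu> ^ 3 + 24 * \<mu>\<^sup>2 + 64 * \<mu>"
    by (simp add: power2_eq_square power3_eq_cube algebra_simps)
  have "m 4 \<le> \<mu> * (m 3 + 24 * m 2 + 192 * m 1 + 512)"
    using m[of 4 3] by (simp add: eq3 lin m_def)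
  also have "\<dots> \<le> \<mu> * (\<mu> ^ 3 + 48 * \<mu>\<^sup>2 + 448 * \<mu> + 512)" using m1 m2 m3 \<mu> by (intro mult_left_mono) auto
  also have "\<dots> = 256 * a ^ 4 + 3072 * a ^ 3 + 7168 * a\<^sup>2 + 2048 * a"
    by (simp add: \<mu>_def eval_nat_numeral algebra_simps)
  \<comment> \<open>The intermediate powers are at most a + a^4, so the coefficients of a and a^4
    add up to 12288 and 10496.\<close>
  also have "\<dots> \<le> 13000 * (a + a ^ 4)"
  proof -
    have "a\<^sup>2 \<le> a + a ^ 4 \<and> a ^ 3 \<le> a + a ^ 4"
    proof (cases "a \<le> 1")
      case True
      then have "a\<^sup>2 \<le> a" "a ^ 3 \<le> a" using a power_decreasing[of 1 _ a] by fastforce+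
      then show ?thesis using a by (simp add: add_increasing2)
    next
      case False
      then have "a\<^sup>2 \<le> a ^ 4" "a ^ 3 \<le> a ^ 4" by (auto intro: power_increasing)
      then show ?thesis using a by simp
    qed
    moreover have "a ^ 4 \<ge> 0" by simp
    ultimately show ?thesis using a unfolding distrib_left by linarith
  qed
  finally show "cube_ex p (pairs V) (\<lambda>x. envelope e x ^ 4) \<le> 13000 * (a + a ^ 4)"
    by (simp add: m_def)
  have "cube_ex p (pairs V) (\<lambda>x. (envelope e x + 12)\<^sup>2) = m 2 + 24 * m 1 + 144"
    by (simp only: eq4 lin cube_ex_const cube_ex_cmult m_def)
  also have "\<dots> \<le> \<mu>\<^sup>2 + 32 * \<mu> + 144" using m1 m2 by simp
  also have "\<dots> = 16 * a\<^sup>2 + 128 * a + 144" by (simp add: \<mu>_def power2_eq_square)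
  also have "\<dots> \<le> 208 * (1 + a\<^sup>2)"
  proof -
    have "2 * a \<le> a\<^sup>2 + 1" "0 \<le> a\<^sup>2" using sum_squares_bound[of a 1] by simp_all
    then show ?thesis unfolding distrib_left by linarith
  qed
  finally show "cube_ex p (pairs V) (\<lambda>x. (envelope e x + 12)\<^sup>2) \<le> 208 * (1 + a\<^sup>2)" .
qed

lemma envelope_product_moment:
  assumes "e1 \<in> pairs V" "e2 \<in> pairs V"
  shows "cube_ex p (pairs V) (\<lambda>x. (envelope e1 x + 12) * (envelope e2 x + 12)) \<le> 208 * (1 + (N * p\<^sup>2)\<^sup>2)"
proof -
  have "cube_ex p (pairs V) (\<lambda>x. (envelope e1 x + 12) * (envelope e2 x + 12)) \<le>
      cube_ex p (pairs V) (\<lambda>x. ((envelope e1 x + 12)\<^sup>2 + (envelope e2 x + 12)\<^sup>2) / 2)"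
  proof (rule cube_ex_mono[OF finite_E])
    have "u * v \<le> (u\<^sup>2 + v\<^sup>2) / 2" for u v :: real
      using sum_squares_bound[of u v] by simp
    then show "(envelope e1 x + 12) * (envelope e2 x + 12) \<le>
        ((envelope e1 x + 12)\<^sup>2 + (envelope e2 x + 12)\<^sup>2) / 2" for x .
  qed
  also have "\<dots> \<le> 208 * (1 + (N * p\<^sup>2)\<^sup>2)"
    using envelope_moments(1)[OF assms(1)] envelope_moments(1)[OF assms(2)]
    by (simp add: cube_ex_divide cube_ex_add[OF finite_E])
  finally show ?thesis .
qed

lemma mono_envelope_product: "mono (\<lambda>x. (envelope e1 x + 4) * (envelope e2 x + 4))"
  by (intro monoI mult_mono add_mono monoD[OF envelope_mono] add_nonneg_nonneg envelope_nonneg) auto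

text \<open>For distinct edges both weights are integrated out, each gaining a factor p. If the
  edges coincide, one weight is bounded by 2 and a single p remains. Either way the constant is 4 *
  208.\<close>

lemma weighted_envelope_product_le:
  assumes e: "e1 \<in> pairs V" "e2 \<in> pairs V" "g1 \<in> pairs V" "g2 \<in> pairs V"
  shows "cube_ex p (pairs V) (\<lambda>x. (of_bool (x g1) + p) * (of_bool (x g2) + p) * ((envelope e1 x + 4) * (envelope e2 x + 4)))
    \<le> (if g1 = g2 then p else p\<^sup>2) * (832 * (1 + (N * p\<^sup>2)\<^sup>2))"
proof (cases "g1 = g2")
  case True
  have "cube_ex p (pairs V) (\<lambda>x. (of_bool (x g1) + p) * (of_bool (x g2) + p) * ((envelope e1 x + 4) * (envelope e2 x + 4)))
    \<le> cube_ex p (pairs V) (\<lambda>x. (of_bool (x g1) + p) * (2 * ((envelope e1 x + 4) * (envelope e2 x + 4))))"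
    unfolding mult.assoc
    using p_gt_0 p_less_1
    by (intro cube_ex_mono[OF finite_E] mult_left_mono mult_right_mono mult_nonneg_nonneg
        add_nonneg_nonneg envelope_nonneg) auto
  also have "\<dots> = 2 * cube_ex p (pairs V) (\<lambda>x. (of_bool (x g1) + p) * ((envelope e1 x + 4) * (envelope e2 x + 4)))"
    unfolding cube_ex_cmult[symmetric] by (simp add: mult_ac)
  also have "\<dots> \<le> 2 * (2 * p * cube_ex p (pairs V)
      (\<lambda>x. (envelope e1 (x(g1 := True)) + 4) * (envelope e2 (x(g1 := True)) + 4)))"
    using cube_ex_weight_le[OF finite_E e(3) mono_envelope_product[of e1 e2]] by simp
  also have "\<dots> \<le> 2 * (2 * p * cube_ex p (pairs V) (\<lambda>x. (envelope e1 x + 12) * (envelope e2 x + 12)))"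
  proof (intro mult_left_mono cube_ex_mono[OF finite_E] mult_mono add_nonneg_nonneg envelope_nonneg)
    fix x
    show "envelope e1 (x(g1 := True)) + 4 \<le> envelope e1 x + 12" "envelope e2 (x(g1 := True)) + 4 \<le> envelope e2 x + 12"
      using envelope_upd_le[OF e(1), of x g1 True] envelope_upd_le[OF e(2), of x g1 True] by linarith+
  qed (use p_gt_0 in auto)
  also have "\<dots> \<le> 2 * (2 * p * (208 * (1 + (N * p\<^sup>2)\<^sup>2)))"
    using p_gt_0 by (intro mult_left_mono envelope_product_moment e) auto
  also have "\<dots> = p * (832 * (1 + (N * p\<^sup>2)\<^sup>2))" by simp
  finally show ?thesis using True by simp
next
  case False
  have "cube_ex p (pairs V) (\<lambda>x. (of_bool (x g1) + p) * (of_bool (x g2) + p) * ((envelope e1 x + 4) * (envelope e2 x + 4)))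
    \<le> 4 * p\<^sup>2 * cube_ex p (pairs V) (\<lambda>x. (envelope e1 (x(g1 := True, g2 := True)) + 4) *
        (envelope e2 (x(g1 := True, g2 := True)) + 4))"
    by (rule cube_ex_weight2_le[OF finite_E e(3,4) False mono_envelope_product])
      (simp add: envelope_nonneg)
  also have "\<dots> \<le> 4 * p\<^sup>2 * cube_ex p (pairs V) (\<lambda>x. (envelope e1 x + 12) * (envelope e2 x + 12))"
  proof (intro mult_left_mono cube_ex_mono[OF finite_E] mult_mono add_nonneg_nonneg envelope_nonneg)
    fix x
    show "envelope e1 (x(g1 := True, g2 := True)) + 4 \<le> envelope e1 x + 12"
      "envelope e2 (x(g1 := True, g2 := True)) + 4 \<le> envelope e2 x + 12"
      using envelope_upd2_le[OF e(1)] envelope_upd2_le[OF e(2)] by (simp_all add: add.commute)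
  qed auto
  also have "\<dots> \<le> 4 * p\<^sup>2 * (208 * (1 + (N * p\<^sup>2)\<^sup>2))"
    by (intro mult_left_mono envelope_product_moment e) auto
  also have "\<dots> = p\<^sup>2 * (832 * (1 + (N * p\<^sup>2)\<^sup>2))" by simp
  finally show ?thesis using False by simp
qed

lemma third_edge_in_pairs:
  assumes "e \<in> pairs V" "f \<in> pairs V" "adjacent e f"
  shows "third_edge e f \<in> pairs V"
  using pairs_Un_adjacent(4)[of e f] assms by (auto simp: pairs_def third_edge_def)

lemma gram_diff_product_le:
  assumes "e1 \<in> pairs V" "e2 \<in> pairs V" "f1 \<in> pairs V" "f2 \<in> pairs V"
    "adjacent e1 f1" "adjacent e2 f2"
  shows "cube_ex p (pairs V) (\<lambda>x. discrete_diff f1 (gram e1) x * discrete_diff f2 (gram e2) x)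
    \<le> (if third_edge e1 f1 = third_edge e2 f2 then p else p\<^sup>2) * (3328 * (1 + (N * p\<^sup>2)\<^sup>2))"
proof -
  let ?g1 = "third_edge e1 f1" and ?g2 = "third_edge e2 f2"
  have "cube_ex p (pairs V) (\<lambda>x. discrete_diff f1 (gram e1) x * discrete_diff f2 (gram e2) x) \<le>
    cube_ex p (pairs V) (\<lambda>x. 4 * ((of_bool (x ?g1) + p) * (of_bool (x ?g2) + p) * ((envelope e1 x + 4) * (envelope e2 x + 4))))"
  proof (rule cube_ex_mono[OF finite_E])
    fix x
    have "discrete_diff f1 (gram e1) x * discrete_diff f2 (gram e2) x \<le>
        (2 * (of_bool (x ?g1) + p) * (envelope e1 x + 4)) * (2 * (of_bool (x ?g2) + p) * (envelope e2 x + 4))"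
      using p_gt_0 assms
      by (intro mult_mono discrete_diff_gram mult_nonneg_nonneg add_nonneg_nonneg envelope_nonneg) auto
    then show "discrete_diff f1 (gram e1) x * discrete_diff f2 (gram e2) x \<le>
        4 * ((of_bool (x ?g1) + p) * (of_bool (x ?g2) + p) * ((envelope e1 x + 4) * (envelope e2 x + 4)))"
      by (rule order_trans) (rule eq_refl, algebra)
  qed
  also have "\<dots> = 4 * cube_ex p (pairs V)
      (\<lambda>x. (of_bool (x ?g1) + p) * (of_bool (x ?g2) + p) * ((envelope e1 x + 4) * (envelope e2 x + 4)))"
    by simp
  also have "\<dots> \<le> 4 * ((if ?g1 = ?g2 then p else p\<^sup>2) * (832 * (1 + (N * p\<^sup>2)\<^sup>2)))"
    using assms by (intro mult_left_mono weighted_envelope_product_le third_edge_in_pairs) auto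
  also have "\<dots> = (if ?g1 = ?g2 then p else p\<^sup>2) * (3328 * (1 + (N * p\<^sup>2)\<^sup>2))" by simp
  finally show ?thesis .
qed


section \<open>Second moments of the sums of \<open>gram\<close>\<close>

lemma card_pairs_le: "real (card (pairs V)) \<le> N\<^sup>2"
proof -
  have "N * (N - 1) \<le> N * N" by (intro mult_left_mono) auto
  moreover have "0 \<le> N * N" by simp
  ultimately have "N * (N - 1) / 2 \<le> N * N" by linarith
  then show ?thesis unfolding card_pairs_real[OF finite_V] power2_eq_square .
qed

text \<open>The order of N^2 edges times p a, with a = N p^2, is rewritten as the scale (N p)^3 in
  which the variance is measured.\<close>

lemma scale_identity: "N\<^sup>2 * p * (N * p\<^sup>2) = (N * p) ^ 3"
  by (simp add: power2_eq_square power3_eq_cube)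

lemma power_le_one_plus_cube:
  fixes a :: real
  assumes "0 \<le> a"
  shows "a \<le> 1 + a ^ 3 \<and> a\<^sup>2 \<le> 1 + a ^ 3"
proof -
  have nn: "0 \<le> a ^ 3" using assms by simp
  show ?thesis
  proof (cases "a \<le> 1")
    case True
    then have "a\<^sup>2 \<le> 1" using assms by (simp add: power_le_one)
    with True nn show ?thesis by linarith
  next
    case False
    then have "a ^ 1 \<le> a ^ 3" "a\<^sup>2 \<le> a ^ 3" by (intro power_increasing; simp)+
    then show ?thesis by simp
  qed
qed

text \<open>The square is expanded and every centred factor integrated by parts. The diagonal leaves
  E gram^2; off the diagonal a product of two crossed differences survives, which vanishes for
  nonadjacent edges.\<close>

lemma gram_fluctuation_le:
  "cube_ex p (pairs V) (\<lambda>x. (\<Sum>e\<in>pairs V. (of_bool (x e) - p) * gram e x)\<^sup>2)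
    \<le> 27000 * ((1 - p) * (N * p) ^ 3 * (1 + (N * p\<^sup>2) ^ 3))"
proof -
  define a where "a = N * p\<^sup>2"
  define q where "q = 1 - p"
  define X where "X = (N * p) ^ 3"
  have a: "0 \<le> a" and q: "0 \<le> q" "q \<le> 1" and X: "0 \<le> X"
    using p_gt_0 p_less_1 by (auto simp: a_def q_def X_def)
  define c1 where "c1 = p * q * (13000 * (a + a ^ 4))"
  define c2 where "c2 = (p * q)\<^sup>2 * (p * (3328 * (1 + a\<^sup>2)))"
  have c: "0 \<le> c1" "0 \<le> c2" using a q p_gt_0 by (auto simp: c1_def c2_def)
  let ?y = "\<lambda>e x. of_bool (x e) - p"
  let ?E = "cube_ex p (pairs V)"
  have diag: "?E (\<lambda>x. (?y e x * gram e x) * (?y e x * gram e x)) \<le> c1" if e: "e \<in> pairs V" for e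
  proof -
    have "?E (\<lambda>x. (?y e x * gram e x) * (?y e x * gram e x)) = ?E (\<lambda>x. ?y e x * (?y e x * (gram e x)\<^sup>2))"
      by (simp add: power2_eq_square mult_ac)
    \<comment> \<open>\<open>gram e\<close> ignores coordinate \<open>e\<close>, and the second
      centred factor has difference 1 there.\<close>
    also have "\<dots> = p * q * ?E (\<lambda>x. (gram e x)\<^sup>2)"
      unfolding cube_ex_centered[OF finite_E e] q_def
      by (simp add: discrete_diff_def [abs_def] algebra_simps)
    also have "?E (\<lambda>x. (gram e x)\<^sup>2) \<le> ?E (\<lambda>x. envelope e x ^ 4)"
    proof (rule cube_ex_mono[OF finite_E])
      fix x
      have "gram e x \<le> envelope e x * envelope e x"
        unfolding gram_def
        by (intro mult_mono tri_coeff_le_envelope tri_deriv_le_envelope tri_deriv_nonneg envelope_nonneg e)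
      then have "(gram e x)\<^sup>2 \<le> (envelope e x * envelope e x)\<^sup>2"
        by (intro power_mono gram_nonneg)
      then show "(gram e x)\<^sup>2 \<le> envelope e x ^ 4" by (simp add: power2_eq_square eval_nat_numeral mult.assoc)
    qed
    also have "\<dots> \<le> 13000 * (a + a ^ 4)"
      unfolding a_def by (rule envelope_moments(2)[OF e])
    finally show ?thesis using p_gt_0 q by (simp add: c1_def mult_left_mono)
  qed
  have off: "?E (\<lambda>x. (?y e x * gram e x) * (?y f x * gram f x)) \<le> (if adjacent e f then c2 else 0)"
    if e: "e \<in> pairs V" and f: "f \<in> pairs V" and ne: "e \<noteq> f" for e f
  proof -
    have "?E (\<lambda>x. (?y e x * gram e x) * (?y f x * gram f x)) = ?E (\<lambda>x. ?y e x * (?y f x * gram e x * gram f x))"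
      by (simp add: mult_ac)
    also have "\<dots> = p * q * ?E (\<lambda>x. ?y f x * (gram e x * discrete_diff e (gram f) x))"
      unfolding cube_ex_centered[OF finite_E e] q_def using ne
      by (simp add: discrete_diff_def [abs_def] algebra_simps)
    \<comment> \<open>Integration by parts at \<open>f\<close>: \<open>gram f\<close> ignores
      coordinate \<open>f\<close>, and so does its difference at \<open>e\<close>.\<close>
    also have "?E (\<lambda>x. ?y f x * (gram e x * discrete_diff e (gram f) x)) =
        p * q * ?E (\<lambda>x. discrete_diff f (gram e) x * discrete_diff e (gram f) x)"
    proof -
      have "discrete_diff e (gram f) (x(f := b)) = discrete_diff e (gram f) x" for x b
        using ne by (simp add: discrete_diff_def fun_upd_twist[of f e])
      then have "discrete_diff f (\<lambda>x. gram e x * discrete_diff e (gram f) x) =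
          (\<lambda>x. discrete_diff f (gram e) x * discrete_diff e (gram f) x)"
        by (intro ext, unfold discrete_diff_def[of f]) (simp add: algebra_simps)
      then show ?thesis unfolding cube_ex_centered[OF finite_E f] q_def by simp
    qed
    finally have eq: "?E (\<lambda>x. (?y e x * gram e x) * (?y f x * gram f x)) =
        (p * q)\<^sup>2 * ?E (\<lambda>x. discrete_diff f (gram e) x * discrete_diff e (gram f) x)"
      by (simp add: power2_eq_square)
    show ?thesis
    proof (cases "adjacent e f")
      case True
      \<comment> \<open>Both differences involve the same third edge, so the coincident case with a
        single factor p applies.\<close>
      with gram_diff_product_le[OF e f f e]
      have "?E (\<lambda>x. discrete_diff f (gram e) x * discrete_diff e (gram f) x) \<le> p * (3328 * (1 + a\<^sup>2))"
        by (simp add: adjacent_sym[of f e] third_edge_sym[of f e] a_def)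
      then show ?thesis unfolding eq using True by (simp add: c2_def mult_left_mono)
    next
      case False
      then show ?thesis unfolding eq by (simp add: discrete_diff_gram_nonadjacent[OF e])
    qed
  qed
  have "?E (\<lambda>x. (\<Sum>e\<in>pairs V. ?y e x * gram e x)\<^sup>2) =
      (\<Sum>e\<in>pairs V. \<Sum>f\<in>pairs V. ?E (\<lambda>x. (?y e x * gram e x) * (?y f x * gram f x)))"
    by (simp add: power2_eq_square sum_product cube_ex_sum[OF finite_E])
  also have "\<dots> \<le> (\<Sum>e\<in>pairs V. c1 + 2 * N * c2)"
  proof (rule sum_mono)
    fix e assume e: "e \<in> pairs V"
    have "(\<Sum>f\<in>pairs V. ?E (\<lambda>x. (?y e x * gram e x) * (?y f x * gram f x))) \<le>
        (\<Sum>f\<in>pairs V. (if f = e then c1 else 0) + (if adjacent e f then c2 else 0))"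
    proof (rule sum_mono)
      fix f assume f: "f \<in> pairs V"
      show "?E (\<lambda>x. (?y e x * gram e x) * (?y f x * gram f x)) \<le>
          (if f = e then c1 else 0) + (if adjacent e f then c2 else 0)"
        using diag[OF e] off[OF e f] c by (cases "f = e") auto
    qed
    also have "\<dots> = c1 + real (card {f \<in> pairs V. adjacent e f}) * c2"
      using e finite_E by (simp add: sum.distrib sum.If_cases Int_def)
    also have "\<dots> \<le> c1 + 2 * N * c2"
      using card_adjacent_le[OF finite_V e] c
      by (intro add_left_mono mult_right_mono) (simp_all flip: of_nat_mult add: mult.commute)
    finally show "(\<Sum>f\<in>pairs V. ?E (\<lambda>x. (?y e x * gram e x) * (?y f x * gram f x))) \<le> c1 + 2 * N * c2" .
  qed
  also have "\<dots> = real (card (pairs V)) * (c1 + 2 * N * c2)" by simp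
  also have "\<dots> \<le> N\<^sup>2 * (c1 + 2 * N * c2)"
    using c by (intro mult_right_mono card_pairs_le) auto
  also have "\<dots> = q * (13000 * (N\<^sup>2 * p * a) * (1 + a ^ 3)) + q * q * (6656 * X * (1 + a\<^sup>2))"
    by (simp add: c1_def c2_def X_def power2_eq_square eval_nat_numeral algebra_simps)
  also have "N\<^sup>2 * p * a = X" unfolding a_def X_def by (rule scale_identity)
  also have "q * q * (6656 * X * (1 + a\<^sup>2)) \<le> 1 * q * (6656 * X * (2 * (1 + a ^ 3)))"
  proof -
    have "1 + a\<^sup>2 \<le> 2 * (1 + a ^ 3)"
      using conjunct2[OF power_le_one_plus_cube[OF a]] zero_le_power[OF a, of 3]
      unfolding distrib_left by linarith
    then show ?thesis using q X by (intro mult_mono) auto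
  qed
  \<comment> \<open>26312 = 13000 + 2 * 6656.\<close>
  finally have "?E (\<lambda>x. (\<Sum>e\<in>pairs V. ?y e x * gram e x)\<^sup>2) \<le> 26312 * (q * X * (1 + a ^ 3))"
    by (simp add: algebra_simps)
  also have "\<dots> \<le> 27000 * (q * X * (1 + a ^ 3))"
    using a q X by (intro mult_right_mono) auto
  finally show ?thesis by (simp add: a_def q_def X_def)
qed

text \<open>By Efron--Stein it suffices to bound the squared influence of one edge \<open>f\<close>,
  and only the at most 2N edges adjacent to \<open>f\<close> respond to it.\<close>

lemma gram_variance_le:
  "(p * (1 - p))\<^sup>2 * (cube_ex p (pairs V) (\<lambda>x. (\<Sum>e\<in>pairs V. gram e x)\<^sup>2) -
      (cube_ex p (pairs V) (\<lambda>x. \<Sum>e\<in>pairs V. gram e x))\<^sup>2)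
    \<le> 40000 * ((1 - p) * (N * p) ^ 3 * (1 + (N * p\<^sup>2) ^ 3))"
proof -
  define a where "a = N * p\<^sup>2"
  define q where "q = 1 - p"
  define X where "X = (N * p) ^ 3"
  have a: "0 \<le> a" and q: "0 \<le> q" "q \<le> 1" and X: "0 \<le> X"
    using p_gt_0 p_less_1 by (auto simp: a_def q_def X_def)
  define c where "c = 3328 * (1 + a\<^sup>2)"
  have c: "0 \<le> c" by (simp add: c_def)
  let ?E = "cube_ex p (pairs V)"
  have diff_le: "?E (\<lambda>x. (discrete_diff f (\<lambda>x. \<Sum>e\<in>pairs V. gram e x) x)\<^sup>2) \<le> (2 * N * p + 4 * N\<^sup>2 * p\<^sup>2) * c"
    if f: "f \<in> pairs V" for f
  proof -
    define A where "A = {e \<in> pairs V. adjacent f e}"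
    have A: "finite A" "A \<subseteq> pairs V" using finite_E by (auto simp: A_def)
    have card_A: "real (card A) \<le> 2 * N"
      using card_adjacent_le[OF finite_V f] unfolding A_def by (simp flip: of_nat_mult add: mult.commute)
    have "discrete_diff f (\<lambda>x. \<Sum>e\<in>pairs V. gram e x) x = (\<Sum>e\<in>A. discrete_diff f (gram e) x)" for x
      unfolding discrete_diff_sum
      by (rule sum.mono_neutral_right[OF finite_E A(2)])
        (auto simp: A_def adjacent_sym[of f] intro: discrete_diff_gram_nonadjacent)
    then have "?E (\<lambda>x. (discrete_diff f (\<lambda>x. \<Sum>e\<in>pairs V. gram e x) x)\<^sup>2) =
        (\<Sum>e1\<in>A. \<Sum>e2\<in>A. ?E (\<lambda>x. discrete_diff f (gram e1) x * discrete_diff f (gram e2) x))"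
      by (simp add: power2_eq_square sum_product cube_ex_sum[OF finite_E])
    also have "\<dots> \<le> (\<Sum>e1\<in>A. \<Sum>e2\<in>A. (if e2 = e1 then p * c else 0) + p\<^sup>2 * c)"
    proof (intro sum_mono)
      fix e1 e2 assume e: "e1 \<in> A" "e2 \<in> A"
      then have "?E (\<lambda>x. discrete_diff f (gram e1) x * discrete_diff f (gram e2) x) \<le>
          (if third_edge e1 f = third_edge e2 f then p else p\<^sup>2) * c"
        unfolding c_def a_def using f
        by (intro gram_diff_product_le) (auto simp: A_def adjacent_sym[of f])
      \<comment> \<open>Distinct edges around \<open>f\<close> have distinct third edges, so the
        weaker factor p instead of p^2 occurs on the diagonal only.\<close>
      also have "third_edge e1 f = third_edge e2 f \<longleftrightarrow> e2 = e1"
        using third_edge_inj[of f e1 e2] by (auto simp: third_edge_sym[of _ f])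
      also have "(if e2 = e1 then p else p\<^sup>2) * c \<le> (if e2 = e1 then p * c else 0) + p\<^sup>2 * c"
        using c by simp
      finally show "?E (\<lambda>x. discrete_diff f (gram e1) x * discrete_diff f (gram e2) x) \<le>
          (if e2 = e1 then p * c else 0) + p\<^sup>2 * c" .
    qed
    also have "\<dots> = real (card A) * (p * c + real (card A) * (p\<^sup>2 * c))"
      using A(1) by (simp add: sum.distrib sum.delta algebra_simps)
    also have "\<dots> \<le> (2 * N) * (p * c + (2 * N) * (p\<^sup>2 * c))"
      using card_A c p_gt_0 by (intro mult_mono add_mono) auto
    finally show ?thesis by (simp add: power2_eq_square algebra_simps)
  qed
  have "?E (\<lambda>x. (\<Sum>e\<in>pairs V. gram e x)\<^sup>2) - (?E (\<lambda>x. \<Sum>e\<in>pairs V. gram e x))\<^sup>2 \<le>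
      p * q * (\<Sum>f\<in>pairs V. ?E (\<lambda>x. (discrete_diff f (\<lambda>x. \<Sum>e\<in>pairs V. gram e x) x)\<^sup>2))"
    unfolding q_def by (rule efron_stein[OF finite_E])
  also have "\<dots> \<le> p * q * (\<Sum>f\<in>pairs V. (2 * N * p + 4 * N\<^sup>2 * p\<^sup>2) * c)"
    using p_gt_0 q by (intro mult_left_mono sum_mono diff_le) auto
  also have "\<dots> = p * q * (real (card (pairs V)) * ((2 * N * p + 4 * N\<^sup>2 * p\<^sup>2) * c))" by simp
  also have "\<dots> \<le> p * q * (N\<^sup>2 * ((2 * N * p + 4 * N\<^sup>2 * p\<^sup>2) * c))"
    using p_gt_0 q c by (intro mult_left_mono mult_right_mono card_pairs_le) auto
  finally have "(p * q)\<^sup>2 * (?E (\<lambda>x. (\<Sum>e\<in>pairs V. gram e x)\<^sup>2) - (?E (\<lambda>x. \<Sum>e\<in>pairs V. gram e x))\<^sup>2) \<le>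
      (p * q)\<^sup>2 * (p * q * (N\<^sup>2 * ((2 * N * p + 4 * N\<^sup>2 * p\<^sup>2) * c)))"
    by (rule mult_left_mono) simp
  also have "\<dots> = q * (q * q) * (X * (2 * p + 4 * a) * c)"
    by (simp add: X_def a_def power2_eq_square power3_eq_cube algebra_simps)
  also have "\<dots> \<le> q * (1 * 1) * (X * (2 * 1 + 4 * a) * c)"
    using q X a c p_gt_0 p_less_1
    by (intro mult_mono mult_left_mono mult_right_mono add_mono) auto
  also have "\<dots> = q * X * (3328 * (2 + 4 * a + 2 * a\<^sup>2 + 4 * a ^ 3))"
    by (simp add: c_def power2_eq_square power3_eq_cube algebra_simps)
  \<comment> \<open>As a and a^2 are at most 1 + a^3, the left factor is at most 3328 (8 + 10
    a^3).\<close>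
  also have "\<dots> \<le> q * X * (40000 * (1 + a ^ 3))"
  proof (intro mult_left_mono)
    have "a ^ 3 \<ge> 0" using a by simp
    moreover have "a \<le> 1 + a ^ 3" "a\<^sup>2 \<le> 1 + a ^ 3" using power_le_one_plus_cube[OF a] by auto
    ultimately show "3328 * (2 + 4 * a + 2 * a\<^sup>2 + 4 * a ^ 3) \<le> 40000 * (1 + a ^ 3)"
      unfolding distrib_left by linarith
  qed (use q X in auto)
  finally show ?thesis by (simp add: a_def q_def X_def mult_ac)
qed

section \<open>Lower bound on the variance and the resulting Kolmogorov bound\<close>

text \<open>The coefficient is at least a third of \<open>tri_deriv e x\<close> and at least a third
  of its mean \<open>m\<close>. The first bound governs small a, the second large a. With fewer than
  three vertices the variance would be zero.\<close>

lemma tri_variance_ge: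
  assumes "card V \<ge> 3"
  shows "p * (1 - p) * (\<Sum>e\<in>pairs V. cube_ex p (pairs V) (gram e))
    \<ge> (1 - p) * (N * p) ^ 3 * (1 + N * p\<^sup>2) / 162"
proof -
  define a where "a = N * p\<^sup>2"
  have a: "0 \<le> a" using p_gt_0 by (simp add: a_def)
  let ?E = "cube_ex p (pairs V)"
  have gram_ge: "(a + a\<^sup>2) / 54 \<le> ?E (gram e)" if e: "e \<in> pairs V" for e
  proof -
    define m where "m = real (card (triples_at V e)) * p\<^sup>2"
    have "real (card (triples_at V e)) = N - 2"
      using card_triples_at[OF finite_V e] assms by (simp add: of_nat_diff)
    moreover have "N \<ge> 3" using assms by simp
    \<comment> \<open>N - 2 is at least N / 3 because N is at least 3.\<close>
    ultimately have "a / 3 \<le> m"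
      using mult_right_mono[of N "3 * real (card (triples_at V e))" "p\<^sup>2"]
      by (simp add: m_def a_def algebra_simps)
    have "card e = 2" using e by (simp add: pairs_def)
    have prod_eq: "prod_on (pairs t - {e}) x * prod_on (pairs t - {e}) x = prod_on (pairs t - {e}) x" for t x
      unfolding prod_on_def prod.distrib[symmetric] by (intro prod.cong) auto
    have "?E (prod_on (pairs t - {e})) = p\<^sup>2" if t: "t \<in> triples_at V e" for t
    proof -
      from t \<open>card e = 2\<close> obtain f g where fg: "pairs t - {e} = {f, g}" "f \<noteq> g" "f \<in> pairs V" "g \<in> pairs V"
        by (rule triples_atE)
      have "prod_on (pairs t - {e}) = (\<lambda>x. of_bool (x f) * (of_bool (x g) * 1))"
        using fg prod_on_2[OF fg(2)] by auto
      then have "?E (prod_on (pairs t - {e})) = ?E (\<lambda>x. of_bool (x f) * (of_bool (x g) * 1))"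
        by (rule arg_cong)
      also have "\<dots> = p * ?E (\<lambda>x. of_bool (x g) * 1)"
        using fg(2) by (subst cube_ex_of_bool_mult[OF finite_E fg(3)]) simp
      also have "\<dots> = p\<^sup>2"
        by (subst cube_ex_of_bool_mult[OF finite_E fg(4)]) (simp add: power2_eq_square)
      finally show ?thesis .
    qed
    then have ex_deriv: "?E (tri_deriv e) = m"
      by (simp add: tri_deriv_def [abs_def] cube_ex_sum[OF finite_E] m_def)
    have pt: "tri_deriv e x / 6 + m * tri_deriv e x / 6 \<le> gram e x" for x
    proof -
      \<comment> \<open>The summands take the values 0 and 1, hence are idempotent, and each is at
        most the whole sum.\<close>
      have "tri_deriv e x \<le> tri_deriv e x * tri_deriv e x"
      proof -
        have "tri_deriv e x = (\<Sum>t\<in>triples_at V e. prod_on (pairs t - {e}) x * prod_on (pairs t - {e}) x)"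
          by (simp add: tri_deriv_def prod_eq)
        also have "\<dots> \<le> (\<Sum>t\<in>triples_at V e. prod_on (pairs t - {e}) x * tri_deriv e x)"
          unfolding tri_deriv_def
          by (intro sum_mono mult_left_mono member_le_sum prod_on_nonneg finite_triples_at[OF finite_V])
        finally show ?thesis by (simp add: tri_deriv_def sum_distrib_right)
      qed
      then have "tri_deriv e x / 3 \<le> tri_deriv e x / 3 * tri_deriv e x" by simp
      moreover have "tri_deriv e x / 3 \<le> tri_coeff e x"
        unfolding tri_deriv_def tri_coeff_def coeff_on_def sum_divide_distrib using p_gt_0
        by (intro sum_mono) (simp add: add_increasing2 sum_nonneg)
      moreover have "m / 3 \<le> tri_coeff e x"
      proof -
        have "m / 3 = (\<Sum>t\<in>triples_at V e. p\<^sup>2 / 3)" by (simp add: m_def)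
        also have "\<dots> \<le> tri_coeff e x"
          unfolding tri_coeff_def coeff_on_def using p_gt_0
          by (intro sum_mono) (simp add: prod_on_nonneg sum_nonneg)
        finally show ?thesis .
      qed
      ultimately have "tri_deriv e x / 3 \<le> tri_deriv e x / 3 * tri_deriv e x"
          "tri_deriv e x / 3 * tri_deriv e x \<le> gram e x" "m / 3 * tri_deriv e x \<le> gram e x"
        unfolding gram_def by (blast intro: mult_right_mono tri_deriv_nonneg)+
      \<comment> \<open>The average of the two lower bounds for \<open>gram e x\<close>.\<close>
      then show ?thesis by linarith
    qed
    have "m / 6 + m * m / 6 = ?E (\<lambda>x. tri_deriv e x / 6 + m * tri_deriv e x / 6)"
      by (simp add: cube_ex_add[OF finite_E] cube_ex_divide ex_deriv)
    also have "\<dots> \<le> ?E (gram e)"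
      by (intro cube_ex_mono[OF finite_E] pt)
    finally have "m / 6 + m * m / 6 \<le> ?E (gram e)" .
    moreover have "(a / 3) / 6 + (a / 3) * (a / 3) / 6 \<le> m / 6 + m * m / 6"
      using \<open>a / 3 \<le> m\<close> a by (intro add_mono divide_right_mono mult_mono) auto
    ultimately show ?thesis using a by (simp add: power2_eq_square field_simps)
  qed
  \<comment> \<open>N (N - 1) / 2 is at least N^2 / 3 from N = 3 on; together with the 54 this
    produces 162.\<close>
  have "N\<^sup>2 / 3 \<le> real (card (pairs V))"
    using assms unfolding card_pairs_real[OF finite_V]
    by (simp add: power2_eq_square field_simps)
  then have "N\<^sup>2 / 3 * ((a + a\<^sup>2) / 54) \<le> real (card (pairs V)) * ((a + a\<^sup>2) / 54)"
    using a by (intro mult_right_mono) auto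
  also have "\<dots> \<le> (\<Sum>e\<in>pairs V. ?E (gram e))"
    using sum_mono[OF gram_ge] by simp
  finally have le: "p * (1 - p) * (N\<^sup>2 / 3 * ((a + a\<^sup>2) / 54)) \<le> p * (1 - p) * (\<Sum>e\<in>pairs V. ?E (gram e))"
    using p_gt_0 p_less_1 by (intro mult_left_mono) auto
  have eq: "p * (1 - p) * (N\<^sup>2 / 3 * ((a + a\<^sup>2) / 54)) = (1 - p) * (N\<^sup>2 * p * a) * (1 + a) / 162"
    by (simp add: power2_eq_square field_simps)
  from le show ?thesis unfolding eq unfolding a_def scale_identity .
qed


lemma kolmogorov_triangle_bound:
  assumes "card V \<ge> 3"
  defines "\<mu> \<equiv> cube_ex p (pairs V) tri"
  defines "s2 \<equiv> cube_ex p (pairs V) (\<lambda>x. (tri x - \<mu>)\<^sup>2)"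
  shows "\<bar>cube_ex p (pairs V) (\<lambda>x. of_bool ((tri x - \<mu>) / sqrt s2 \<le> z)) - cdf std_normal_distribution z\<bar>
    \<le> 90000 * sqrt ((1 + N * p\<^sup>2) / ((1 - p) * (N * p) ^ 3))"
proof -
  let ?E = "cube_ex p (pairs V)"
  define a where "a = N * p\<^sup>2"
  define R where "R = (1 - p) * (N * p) ^ 3"
  have N: "N \<ge> 3" using assms(1) by simp
  have a: "a > 0" and R: "R > 0"
    using p_gt_0 p_less_1 N by (auto simp: a_def R_def)
  define G where "G e x = tri_coeff e x * discrete_diff e tri x" for e x
  have G: "G e x = gram e x" if "e \<in> pairs V" for e x
    using that by (simp add: G_def gram_def discrete_diff_tri)
  define v where "v = p * (1 - p) * (\<Sum>e\<in>pairs V. ?E (G e))"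
  have "?E (G e) = ?E (gram e)" if "e \<in> pairs V" for e
    using G[OF that] by (metis ext)
  then have "v = p * (1 - p) * (\<Sum>e\<in>pairs V. ?E (gram e))"
    by (simp add: v_def)
  with tri_variance_ge[OF assms(1)] have v: "R * (1 + a) / 162 \<le> v"
    by (simp add: R_def a_def)
  moreover have "0 < R * (1 + a) / 162" using R a by simp
  ultimately have v_pos: "v > 0" by linarith
  note stein = stein_kolmogorov_bound[OF finite_E tri_expansion tri_coeff_upd tri_coeff_nonneg
      discrete_diff_tri_nonneg, folded G_def, folded v_def, OF v_pos]
  have \<mu>: "\<mu> = real (card (triples V)) * p ^ 3"
    unfolding \<mu>_def by (rule stein(1))
  have s2: "s2 = v"
    unfolding s2_def \<mu> by (rule stein(2))
  define F where "F = R * (1 + a ^ 3)"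
  have F: "F \<ge> 0" using R a by (simp add: F_def)
  let ?var = "?E (\<lambda>x. (\<Sum>e\<in>pairs V. gram e x)\<^sup>2) - (?E (\<lambda>x. \<Sum>e\<in>pairs V. gram e x))\<^sup>2"
  let ?fluct = "?E (\<lambda>x. (\<Sum>e\<in>pairs V. (of_bool (x e) - p) * gram e x)\<^sup>2)"
  have "\<bar>?E (\<lambda>x. of_bool ((tri x - \<mu>) / sqrt s2 \<le> z)) - cdf std_normal_distribution z\<bar>
      \<le> (p * (1 - p) * sqrt ?var + 2 * sqrt ?fluct) / v"
    using stein(3)[of z] by (simp add: \<mu> s2 G)
  \<comment> \<open>The constants are roots: 200^2 = 40000 and 170^2 = 28900, which exceeds
    27000.\<close>
  also have "\<dots> \<le> (200 * sqrt F + 2 * (170 * sqrt F)) / v"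
  proof (intro divide_right_mono add_mono mult_left_mono)
    have "p * (1 - p) * sqrt ?var = sqrt ((p * (1 - p))\<^sup>2 * ?var)"
      using p_gt_0 p_less_1 by (simp add: real_sqrt_mult)
    also have "\<dots> \<le> sqrt (40000 * F)"
      using gram_variance_le by (intro real_sqrt_le_mono) (simp add: F_def R_def a_def)
    also have "\<dots> = 200 * sqrt F"
      using real_sqrt_mult[of "200 * 200" F] by simp
    finally show "p * (1 - p) * sqrt ?var \<le> 200 * sqrt F" .
    have "sqrt ?fluct \<le> sqrt (170 * 170 * F)"
    proof (rule real_sqrt_le_mono)
      have "?fluct \<le> 27000 * F"
        using gram_fluctuation_le by (simp add: F_def R_def a_def)
      with F show "?fluct \<le> 170 * 170 * F" by linarith
    qed
    also have "\<dots> = 170 * sqrt F"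
      using real_sqrt_mult[of "170 * 170" F] by simp
    finally show "sqrt ?fluct \<le> 170 * sqrt F" .
  qed (use v_pos in auto)
  also have "\<dots> = 540 * sqrt F / v" by simp
  also have "\<dots> \<le> 540 * sqrt F / (R * (1 + a) / 162)"
    using v v_pos R a F by (intro divide_left_mono mult_pos_pos) auto
  \<comment> \<open>Passing from 1 + a^3 to (1 + a)^3 makes numerator and denominator combine into a
    single root; the constant is 540 * 162 = 87480.\<close>
  also have "\<dots> \<le> 540 * sqrt (R * (1 + a) ^ 3) / (R * (1 + a) / 162)"
  proof (intro divide_right_mono mult_left_mono real_sqrt_le_mono)
    have "(1 + a) ^ 3 = 1 + a ^ 3 + 3 * a * (1 + a)"
      by (simp add: power3_eq_cube algebra_simps)
    then show "F \<le> R * (1 + a) ^ 3"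
      unfolding F_def using R a by (intro mult_left_mono) auto
  qed (use R a in auto)
  also have "\<dots> = 87480 * sqrt ((1 + a) / R)"
  proof -
    have "R * (1 + a) ^ 3 = (R * (1 + a))\<^sup>2 * ((1 + a) / R)"
      using R by (simp add: power2_eq_square power3_eq_cube)
    then have "sqrt (R * (1 + a) ^ 3) = R * (1 + a) * sqrt ((1 + a) / R)"
      using R a by (simp only: real_sqrt_mult) simp
    then show ?thesis using R a by simp
  qed
  also have "\<dots> \<le> 90000 * sqrt ((1 + a) / R)"
    using R a by (intro mult_right_mono) auto
  finally show ?thesis by (simp add: a_def R_def)
qed

end

section \<open>Counting triangles in a random graph\<close>

lemma edges_complete_graph: "edges (complete_graph V) = pairs V"
  by (simp add: complete_graph_def pairs_def)

lemma graph_isomorphic_complete: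
  assumes "finite U" "card W = card U" "card U \<noteq> 0"
  shows "graph_isomorphic (complete_graph W) (complete_graph U)"
proof -
  have "finite W" using assms by (intro card_ge_0_finite) (simp add: card_gt_0_iff)
  then obtain f where f: "bij_betw f W U"
    using finite_same_card_bij[OF _ assms(1,2)] by blast
  have "(\<lambda>e. f ` e) ` pairs W = pairs U"
  proof
    show "(\<lambda>e. f ` e) ` pairs W \<subseteq> pairs U"
      using f by (auto simp: pairs_def bij_betw_def card_image inj_on_subset)
    show "pairs U \<subseteq> (\<lambda>e. f ` e) ` pairs W"
    proof
      fix e assume e: "e \<in> pairs U"
      let ?g = "inv_into W f"
      have g: "bij_betw ?g U W" by (rule bij_betw_inv_into[OF f])
      have "?g ` e \<in> pairs W"
        using e g by (auto simp: pairs_def bij_betw_def card_image inj_on_subset)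
      moreover have "f ` ?g ` e = e"
        using e f by (intro image_inv_into_cancel) (auto simp: pairs_def bij_betw_def)
      ultimately show "e \<in> (\<lambda>e. f ` e) ` pairs W" by (metis image_eqI)
    qed
  qed
  with f show ?thesis
    unfolding graph_isomorphic_def edges_complete_graph by (auto simp: complete_graph_def)
qed

text \<open>Simplicity gives one inclusion of the edge sets. Conversely, a pair of vertices has the
  same image as some edge, and the bijection is injective on subsets, so the pair is that
  edge.\<close>

lemma simple_graph_isomorphic_complete:
  assumes "simple_graph H" "graph_isomorphic H (complete_graph U)"
  shows "H = complete_graph (verts H)" "card (verts H) = card U"
proof -
  obtain f where f: "bij_betw f (verts H) U" and edges: "(\<lambda>e. f ` e) ` edges H = pairs U"
    using assms(2) unfolding graph_isomorphic_def edges_complete_graph by (auto simp: complete_graph_def)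
  have H: "edges H \<subseteq> pairs (verts H)"
    using assms(1) by (simp add: simple_graph_def edges_complete_graph)
  have "pairs (verts H) \<subseteq> edges H"
  proof
    fix e assume e: "e \<in> pairs (verts H)"
    then have "f ` e \<in> pairs U"
      using f by (auto simp: pairs_def bij_betw_def card_image inj_on_subset)
    then obtain e' where e': "e' \<in> edges H" "f ` e = f ` e'"
      unfolding edges[symmetric] by blast
    have "e = e'"
      using inj_on_image_eq_iff[of f "verts H" e e'] f e e' H by (auto simp: bij_betw_def pairs_def)
    with e' show "e \<in> edges H" by simp
  qed
  with H show "H = complete_graph (verts H)"
    by (intro prod_eqI) (auto simp: edges_complete_graph complete_graph_def pairs_def)
  show "card (verts H) = card U"
    using f by (rule bij_betw_same_card)
qed

text \<open>A copy of the triangle is determined by its vertex set, which turns counting subgraphs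
  into counting triples with all three pairs present.\<close>

lemma triangle_subgraphs:
  assumes "is_triangle G"
  shows "{H. subgraph H (V, F) \<and> graph_isomorphic H G} = complete_graph ` {t \<in> triples V. pairs t \<subseteq> F}"
proof -
  obtain U where U: "card U = 3" "G = complete_graph U"
    using assms by (auto simp: is_triangle_def)
  have fin: "finite U" using U(1) by (auto intro: card_ge_0_finite)
  show ?thesis
  proof
    show "{H. subgraph H (V, F) \<and> graph_isomorphic H G} \<subseteq> complete_graph ` {t \<in> triples V. pairs t \<subseteq> F}"
    proof
      fix H assume "H \<in> {H. subgraph H (V, F) \<and> graph_isomorphic H G}"
      then have H: "simple_graph H" "verts H \<subseteq> V" "edges H \<subseteq> F" "graph_isomorphic H (complete_graph U)"
        using U by (auto simp: subgraph_def)
      note iso = simple_graph_isomorphic_complete[OF H(1,4)]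
      have "pairs (verts H) \<subseteq> F"
        using H(3) iso(1) edges_complete_graph by metis
      with iso H(2) U show "H \<in> complete_graph ` {t \<in> triples V. pairs t \<subseteq> F}"
        by (intro image_eqI[of _ _ "verts H"]) (auto simp: triples_def)
    qed
    show "complete_graph ` {t \<in> triples V. pairs t \<subseteq> F} \<subseteq> {H. subgraph H (V, F) \<and> graph_isomorphic H G}"
    proof (rule image_subsetI)
      fix t assume t: "t \<in> {t \<in> triples V. pairs t \<subseteq> F}"
      then have "graph_isomorphic (complete_graph t) G"
        using graph_isomorphic_complete[OF fin, of t] U by (simp add: triples_def)
      moreover have "verts (complete_graph t) = t" by (simp add: complete_graph_def)
      ultimately show "complete_graph t \<in> {H. subgraph H (V, F) \<and> graph_isomorphic H G}"
        using t by (simp add: subgraph_def simple_graph_def triples_def edges_complete_graph)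
    qed
  qed
qed

context triangle_cube
begin

lemma subgraph_count_eq_tri:
  assumes "is_triangle G"
  shows "real (subgraph_count G (V, {e \<in> pairs V. x e})) = tri x"
proof -
  have "inj_on complete_graph S" for S :: "'v set set"
    by (auto simp: inj_on_def complete_graph_def)
  then have "subgraph_count G (V, {e \<in> pairs V. x e}) = card {t \<in> triples V. pairs t \<subseteq> {e \<in> pairs V. x e}}"
    unfolding subgraph_count_def triangle_subgraphs[OF assms] by (intro card_image)
  also have "real \<dots> = (\<Sum>t\<in>triples V. of_bool (pairs t \<subseteq> {e \<in> pairs V. x e}))"
    using finite_triples[OF finite_V] by (simp add: Int_def)
  also have "\<dots> = tri x"
    unfolding tri_def
  proof (rule sum.cong)
    fix t assume t: "t \<in> triples V"
    then have sub: "pairs t \<subseteq> pairs V" by (auto simp: triples_def pairs_def)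
    show "of_bool (pairs t \<subseteq> {e \<in> pairs V. x e}) = prod_on (pairs t) x"
    proof (cases "\<forall>e\<in>pairs t. x e")
      case True
      then show ?thesis using sub by (auto simp: prod_on_def)
    next
      case False
      then have "prod_on (pairs t) x = 0"
        unfolding prod_on_def using finite_pairs_triple[OF t] by (intro prod_zero) auto
      with False show ?thesis by auto
    qed
  qed simp
  finally show ?thesis .
qed

end

lemma prob_pmf_eq_expectation:
  "measure_pmf.prob M {x. Q x} = measure_pmf.expectation M (\<lambda>x. of_bool (Q x))"
proof -
  have "indicator {x. Q x} = (\<lambda>x. of_bool (Q x) :: real)"
    by (auto simp: indicator_def)
  then show ?thesis
    using Bochner_Integration.integral_indicator[of "measure_pmf M" "{x. Q x}"] by simp
qed

lemma kolmogorov_dist_triangle_count: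
  assumes G: "is_triangle G" and n: "3 \<le> n" and p: "0 < p" "p < 1"
  shows "kolmogorov_dist (normalized_subgraph_count_law G n p) std_normal_distribution
    \<le> 90000 * sqrt ((1 + real n * p\<^sup>2) / ((1 - p) * (real n * p) ^ 3))"
proof -
  let ?V = "{1..n}"
  interpret triangle_cube p ?V
    by unfold_locales (use p in auto)
  let ?\<Gamma> = "\<lambda>x. (?V, {e \<in> pairs ?V. x e})"
  let ?P = "Pi_pmf (pairs ?V) False (\<lambda>_. bernoulli_pmf p)"
  let ?X = "\<lambda>K :: nat graph. real (subgraph_count G K)"
  have law: "erdos_renyi n p = map_pmf ?\<Gamma> ?P"
    unfolding erdos_renyi_def edges_complete_graph Let_def ..
  have ex: "measure_pmf.expectation (erdos_renyi n p) g = cube_ex p (pairs ?V) (\<lambda>x. g (?\<Gamma> x))"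
    for g :: "nat graph \<Rightarrow> real"
    by (simp add: law cube_ex_def)
  note count = subgraph_count_eq_tri[OF G]
  define \<mu> where "\<mu> = cube_ex p (pairs ?V) tri"
  define s2 where "s2 = cube_ex p (pairs ?V) (\<lambda>x. (tri x - \<mu>)\<^sup>2)"
  have norm: "normalized (erdos_renyi n p) ?X (?\<Gamma> x) = (tri x - \<mu>) / sqrt s2" for x
    unfolding normalized_def ex count s2_def \<mu>_def ..
  have cdf: "cdf (normalized_subgraph_count_law G n p) z =
      cube_ex p (pairs ?V) (\<lambda>x. of_bool ((tri x - \<mu>) / sqrt s2 \<le> z))" for z
  proof -
    have "cdf (normalized_subgraph_count_law G n p) z =
        measure_pmf.prob (erdos_renyi n p) {K. normalized (erdos_renyi n p) ?X K \<le> z}"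
      unfolding normalized_subgraph_count_law_def cdf_def
      by (subst measure_distr) (auto simp: vimage_def)
    also have "\<dots> = measure_pmf.expectation (erdos_renyi n p)
        (\<lambda>K. of_bool (normalized (erdos_renyi n p) ?X K \<le> z))"
      by (rule prob_pmf_eq_expectation)
    finally show ?thesis unfolding ex norm .
  qed
  show ?thesis
    unfolding kolmogorov_dist_def cdf
    by (rule cSUP_least)
      (use kolmogorov_triangle_bound n in \<open>auto simp: s2_def \<mu>_def\<close>)
qed

section \<open>The three regimes of the edge probability\<close>

theorem corollary1p1:
  fixes G :: "'a graph" and c :: real
  assumes "is_triangle G" and "0 < c" and "c < 1"
  shows "\<exists>C>0. \<forall>p :: nat \<Rightarrow> real. (\<forall>n. 0 < p n \<and> p n < 1) \<longrightarrow>
    (\<forall>n\<ge>3.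
      (c < p n \<and> p n < 1 \<longrightarrow>
        kolmogorov_dist (normalized_subgraph_count_law G n (p n)) std_normal_distribution
          \<le> C * (1 / (real n * sqrt (1 - p n)))) \<and>
      (real n powr (- 1 / 2) < p n \<and> p n \<le> c \<longrightarrow>
        kolmogorov_dist (normalized_subgraph_count_law G n (p n)) std_normal_distribution
          \<le> C * (1 / (real n * sqrt (p n)))) \<and>
      (0 < p n \<and> p n \<le> real n powr (- 1 / 2) \<longrightarrow>
        kolmogorov_dist (normalized_subgraph_count_law G n (p n)) std_normal_distribution
          \<le> C * (1 / (real n * p n) powr (3 / 2))))"
proof -
  \<comment> \<open>One summand for each regime, in the order of the statement.\<close>
  define K where "K = sqrt (2 / c ^ 3) + sqrt (2 / (1 - c)) + sqrt 6"
  have K: "sqrt (2 / c ^ 3) \<le> K" "sqrt (2 / (1 - c)) \<le> K" "sqrt 6 \<le> K" "0 < K"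
    using assms by (auto simp: K_def add_nonneg_pos)
  let ?d = "\<lambda>n p. kolmogorov_dist (normalized_subgraph_count_law G n p) std_normal_distribution"
  let ?b = "\<lambda>n p. (1 + real n * p\<^sup>2) / ((1 - p) * (real n * p) ^ 3)"
  \<comment> \<open>\<open>r\<close> is the target rate. Comparing under the root, with
    \<open>k\<close> as squared constant, reduces every regime to a rational inequality.\<close>
  have reduce: "?d n p \<le> 90000 * K * r"
    if n: "3 \<le> n" and p: "0 < p" "p < 1" and r: "?b n p \<le> k * r\<^sup>2" "sqrt k \<le> K" "0 \<le> r" for n p k r
  proof -
    have "sqrt (?b n p) \<le> sqrt k * r"
      using real_sqrt_le_mono[OF r(1)] r(3) by (simp add: real_sqrt_mult)
    also have "\<dots> \<le> K * r" using r by (intro mult_right_mono)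
    finally show ?thesis
      using kolmogorov_dist_triangle_count[OF assms(1) n p] by simp
  qed
  have threshold: "real n powr (- 1 / 2) = 1 / sqrt (real n)" for n :: nat
    using powr_minus[of "real n" "1 / 2"] by (simp add: powr_half_sqrt inverse_eq_divide)
  have dense: "?d n p \<le> 90000 * K * (1 / (real n * sqrt (1 - p)))"
    if n: "3 \<le> n" and p: "0 < p" "p < 1" and cp: "c < p" for n p
  proof (rule reduce[OF n p _ K(1)])
    have "?b n p = (1 / (real n * p ^ 3) + 1 / p) * (1 / (real n * sqrt (1 - p)))\<^sup>2"
      using n p by (simp add: power_mult_distrib power_divide field_simps power2_eq_square power3_eq_cube)
    \<comment> \<open>Both terms are at most 1 / c^3, as c < p, c < 1 and n is at least 1.\<close>
    also have "\<dots> \<le> (1 / c ^ 3 + 1 / c ^ 3) * (1 / (real n * sqrt (1 - p)))\<^sup>2"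
    proof (intro mult_right_mono add_mono frac_le)
      have "c ^ 3 \<le> p ^ 3" using cp assms by (intro power_mono) auto
      also have "\<dots> \<le> real n * p ^ 3" using n p by simp
      finally show "c ^ 3 \<le> real n * p ^ 3" .
      have "c ^ 3 \<le> c ^ 1" using assms by (intro power_decreasing) auto
      with cp show "c ^ 3 \<le> p" by simp
    qed (use assms in auto)
    finally show "?b n p \<le> 2 / c ^ 3 * (1 / (real n * sqrt (1 - p)))\<^sup>2" by simp
  qed (use p in simp)
  have middle: "?d n p \<le> 90000 * K * (1 / (real n * sqrt p))"
    if n: "3 \<le> n" and p: "0 < p" "p < 1" and lo: "real n powr (- 1 / 2) < p" and hi: "p \<le> c" for n p
  proof (rule reduce[OF n p _ K(2)])
    have "(1 / sqrt (real n))\<^sup>2 < p\<^sup>2"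
      using lo unfolding threshold by (intro power_strict_mono) auto
    then have "1 < real n * p\<^sup>2"
      using n by (simp add: power_divide field_simps)
    \<comment> \<open>Here a = n p^2 exceeds 1, so 1 + a is at most 2a.\<close>
    then have "?b n p \<le> (2 * (real n * p\<^sup>2)) / ((1 - p) * (real n * p) ^ 3)"
      using p n by (intro divide_right_mono) auto
    also have "\<dots> = 2 / (1 - p) * (1 / (real n * sqrt p))\<^sup>2"
      using n p by (simp add: power_mult_distrib power_divide field_simps power2_eq_square power3_eq_cube)
    also have "\<dots> \<le> 2 / (1 - c) * (1 / (real n * sqrt p))\<^sup>2"
      using hi assms by (intro mult_right_mono divide_left_mono) auto
    finally show "?b n p \<le> 2 / (1 - c) * (1 / (real n * sqrt p))\<^sup>2" .
  qed (use p in simp)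
  have sparse: "?d n p \<le> 90000 * K * (1 / (real n * p) powr (3 / 2))"
    if n: "3 \<le> n" and p: "0 < p" "p < 1" and hi: "p \<le> real n powr (- 1 / 2)" for n p
  proof (rule reduce[OF n p _ K(3)])
    have sq: "p\<^sup>2 \<le> (1 / sqrt (real n))\<^sup>2"
      using hi p unfolding threshold by (intro power_mono) auto
    then have np: "real n * p\<^sup>2 \<le> 1"
      using n by (simp add: power_divide field_simps)
    \<comment> \<open>Since n is at least 3, p is at most 1 / sqrt 3 and thus below 2/3. So 1 - p is
      at least 1/3, and 1 + a at most 2 gives the constant 6.\<close>
    have "p\<^sup>2 \<le> 1 / real n" using sq by (simp add: power_divide)
    also have "\<dots> \<le> 1 / 3" using n by (intro divide_left_mono) auto
    also have "\<dots> \<le> (2 / 3)\<^sup>2" by (simp add: power2_eq_square)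
    finally have "p \<le> 2 / 3" by (rule power2_le_imp_le) simp
    with np p n have "?b n p \<le> 2 / (1 / 3 * (real n * p) ^ 3)"
      by (intro frac_le mult_right_mono mult_pos_pos) auto
    also have "\<dots> = 6 * (1 / (real n * p) powr (3 / 2))\<^sup>2"
    proof -
      have "((real n * p) powr (3 / 2))\<^sup>2 = (real n * p) powr 3"
        by (simp add: power2_eq_square flip: powr_add)
      then show ?thesis using n p by (simp add: power_divide powr_numeral)
    qed
    finally show "?b n p \<le> 6 * (1 / (real n * p) powr (3 / 2))\<^sup>2" .
  qed simp
  show ?thesis
    by (rule exI[of _ "90000 * K"]) (use K(4) dense middle sparse in simp)
qed

end
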